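(* Let $G$ be a finite, connected metric tree, let $L_{\max}$ denote the length of the longest edge in $G$, and let $\lambda_1(G) \leq \lambda_2(G) \leq \dots$ be the eigenvalues of the standard Laplacian $-\Delta_G$, counted with multiplicities. Then the estimate $$\lambda_{k+1}(G) \leq \frac{k^2 \pi^2}{L_{\max}^2}$$ holds for all $k \in \mathbb{N} = \{1,2,\dots\}$. If $G$ contains two edges with rationally independent lengths, then this inequality is strict for all $k \in \mathbb{N}$.
   Context: A finite metric graph $G$ consists of a finite vertex set $V$, a finite edge set $E$ (with at least one edge) and a length function $L : E \to (0,\infty)$; each edge $e$ is identified with the interval $[0, L(e)]$, running from its originating vertex $o(e)$ (coordinate $0$) to its terminal vertex $t(e)$ (coordinate $L(e)$). $G$ is a tree if it is connected and contains no cycles (equivalently, it is connected and $|V| = |E|+1$). $L_{\max} = \max_{e \in E} L(e)$. Two edges $e, \hat e$ have rationally independent lengths if $L(e)$ and $L(\hat e)$ are linearly independent over $\mathbb{Q}$, i.e. $L(e)/L(\hat e) \notin \mathbb{Q}$. $L^2(G)$ is the space of square-integrable functions $f : G \to \mathbb{C}$, and $f_e$ denotes the restriction of $f$ to $e$, viewed as a function on $[0,L(e)]$. Let $\widetilde H^k(G) = \bigoplus_{e \in E} H^k(e)$ and let $H^1(G)$ be the set of $f \in \widetilde H^1(G)$ that are continuous on $G$ (the limit values at each vertex $v$ coincide along all edges incident to $v$). For $f \in H^1(G) \cap \widetilde H^2(G)$ and $v \in V$ put $\partial_\nu f(v) = \sum_{t(e)=v} f_e'(L(e)) - \sum_{o(e)=v}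 f_e'(0)$. The standard Laplacian $-\Delta_G$ in $L^2(G)$ acts by $(-\Delta_G f)_e = -f_e''$ on the domain of all $f \in H^1(G) \cap \widetilde H^2(G)$ with $\partial_\nu f(v) = 0$ for all $v \in V$. It is selfadjoint with purely discrete, nonnegative spectrum; its eigenvalues, counted with multiplicities and listed in nondecreasing order, are $0 = \lambda_1(G) \leq \lambda_2(G) \leq \dots$, and they satisfy $$\lambda_k(G) = \min_{F \subset H^1(G),\ \dim F = k}\ \max_{f \in F,\ f \neq 0} \frac{\int_G |f'|^2\,dx}{\int_G |f|^2\,dx}, \quad k = 1, 2, \dots.$$ *)

theory Defs
  imports "HOL-Analysis.Analysis" "HOL-Library.Function_Algebras" "Graph_Theory.Digraph_Component"
begin

section \<open>Finite metric graphs and trees\<close>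

text \<open>
  The underlying combinatorial graph is a finite digraph in which loops and parallel edges are
  allowed. The edge \<open>e\<close> is identified with the interval \<open>[0, L e]\<close>; its originating
  vertex is \<open>tail G e\<close> and its terminal vertex is \<open>head G e\<close>.
\<close>

locale metric_graph = fin_digraph G for G :: "('v, 'e) pre_digraph" +
  fixes L :: "'e \<Rightarrow> real"
  assumes arcs_nonempty: "arcs G \<noteq> {}"
    and length_pos: "e \<in> arcs G \<Longrightarrow> 0 < L e"

text \<open>
  The orientation of the edges only fixes the parametrisation, so cycles must be allowed to run
  through an edge in either direction. (The constant \<open>tree\<close> of the graph library
  excludes directed cycles only and is therefore not used.) A traversal \<open>(e, b)\<close> follows
  the edge \<open>e\<close> along its orientation iff \<open>b\<close> holds.
\<close>

definition trav_start :: "('v, 'e) pre_digraph \<Rightarrow> 'e \<times> bool \<Rightarrow> 'v" where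
  "trav_start G d = (if snd d then tail G (fst d) else head G (fst d))"

definition trav_end :: "('v, 'e) pre_digraph \<Rightarrow> 'e \<times> bool \<Rightarrow> 'v" where
  "trav_end G d = (if snd d then head G (fst d) else tail G (fst d))"

definition undirected_cycle :: "('v, 'e) pre_digraph \<Rightarrow> ('e \<times> bool) list \<Rightarrow> bool" where
  "undirected_cycle G p \<longleftrightarrow>
     p \<noteq> [] \<and> fst ` set p \<subseteq> arcs G \<and>
     (\<forall>i < length p. trav_end G (p ! i) = trav_start G (p ! (Suc i mod length p))) \<and>
     distinct (map fst p) \<and> distinct (map (trav_start G) p)"

text \<open>The library's \<open>connected\<close> is connectedness of the underlying undirected graph.\<close>

definition undirected_tree :: "('v, 'e) pre_digraph \<Rightarrow> bool" where
  "undirected_tree G \<longleftrightarrow> Digraph_Component.connected G \<and> (\<nexists>p. undirected_cycle G p)"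

definition max_length :: "('v, 'e) pre_digraph \<Rightarrow> ('e \<Rightarrow> real) \<Rightarrow> real" where
  "max_length G L = Max (L ` arcs G)"


section \<open>Sobolev spaces on an interval\<close>

definition L2_on :: "real \<Rightarrow> (real \<Rightarrow> complex) \<Rightarrow> bool" where
  "L2_on l g \<longleftrightarrow>
     g \<in> borel_measurable (lebesgue_on {0..l}) \<and>
     integrable (lebesgue_on {0..l}) (\<lambda>x. (cmod (g x))\<^sup>2)"

text \<open>
  Members of \<open>H\<^sup>1(0,l)\<close> are represented by their continuous representatives, which are the
  antiderivatives on \<open>[0,l]\<close> of square-integrable functions; \<open>g\<close> is the weak
  derivative and is unique up to null sets.
\<close>

definition has_weak_derivative ::
    "real \<Rightarrow> (real \<Rightarrow> complex) \<Rightarrow> (real \<Rightarrow> complex) \<Rightarrow> bool" where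
  "has_weak_derivative l f g \<longleftrightarrow>
     L2_on l g \<and> (\<forall>x \<in> {0..l}. f x = f 0 + (LINT t:{0..x}|lebesgue. g t))"

definition H1_on :: "real \<Rightarrow> (real \<Rightarrow> complex) \<Rightarrow> bool" where
  "H1_on l f \<longleftrightarrow> (\<exists>g. has_weak_derivative l f g)"

text \<open>
  The continuous representative of a member of \<open>H\<^sup>2(0,l)\<close> is continuously differentiable up to
  the end points (with one-sided derivatives there), and its derivative lies in
  \<open>H\<^sup>1(0,l)\<close>.
\<close>

definition edge_deriv :: "real \<Rightarrow> (real \<Rightarrow> complex) \<Rightarrow> real \<Rightarrow> complex" where
  "edge_deriv l f x = vector_derivative f (at x within {0..l})"

definition H2_on :: "real \<Rightarrow> (real \<Rightarrow> complex) \<Rightarrow> bool" where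
  "H2_on l f \<longleftrightarrow>
     (\<forall>x \<in> {0..l}. f differentiable (at x within {0..l})) \<and> H1_on l (edge_deriv l f)"


section \<open>The standard Laplacian\<close>

text \<open>
  A function on the graph is a family \<open>f\<close> with \<open>f e\<close> its restriction to the
  edge \<open>e\<close>, as a function on \<open>[0, L e]\<close>. So that equality of functions is equality
  on the graph (as needed for dimensions), the family is required to vanish off the graph.
\<close>

type_synonym 'e graph_fun = "'e \<Rightarrow> real \<Rightarrow> complex"

definition supported_on_graph ::
    "('v, 'e) pre_digraph \<Rightarrow> ('e \<Rightarrow> real) \<Rightarrow> 'e graph_fun \<Rightarrow> bool" where
  "supported_on_graph G L f \<longleftrightarrow> (\<forall>e x. \<not> (e \<in> arcs G \<and> x \<in> {0..L e}) \<longrightarrow> f e x = 0)"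

definition continuous_at_vertices ::
    "('v, 'e) pre_digraph \<Rightarrow> ('e \<Rightarrow> real) \<Rightarrow> 'e graph_fun \<Rightarrow> bool" where
  "continuous_at_vertices G L f \<longleftrightarrow>
     (\<exists>\<phi>. \<forall>e \<in> arcs G. f e 0 = \<phi> (tail G e) \<and> f e (L e) = \<phi> (head G e))"

definition H1_graph ::
    "('v, 'e) pre_digraph \<Rightarrow> ('e \<Rightarrow> real) \<Rightarrow> 'e graph_fun set" where
  "H1_graph G L =
     {f. supported_on_graph G L f \<and> (\<forall>e \<in> arcs G. H1_on (L e) (f e)) \<and>
         continuous_at_vertices G L f}"

definition normal_deriv ::
    "('v, 'e) pre_digraph \<Rightarrow> ('e \<Rightarrow> real) \<Rightarrow> 'e graph_fun \<Rightarrow> 'v \<Rightarrow> complex" where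
  "normal_deriv G L f v =
     (\<Sum>e | e \<in> arcs G \<and> head G e = v. edge_deriv (L e) (f e) (L e)) -
     (\<Sum>e | e \<in> arcs G \<and> tail G e = v. edge_deriv (L e) (f e) 0)"

definition laplacian_domain ::
    "('v, 'e) pre_digraph \<Rightarrow> ('e \<Rightarrow> real) \<Rightarrow> 'e graph_fun set" where
  "laplacian_domain G L =
     {f \<in> H1_graph G L. (\<forall>e \<in> arcs G. H2_on (L e) (f e)) \<and>
                        (\<forall>v \<in> verts G. normal_deriv G L f v = 0)}"

text \<open>
  \<open>neg_laplacian G L f h\<close> means that \<open>f\<close> is in the domain and
  \<open>-\<Delta> f = h\<close> in the sense of \<open>L\<^sup>2\<close>, i.e. almost everywhere on each edge.
\<close>

definition neg_laplacian ::
    "('v, 'e) pre_digraph \<Rightarrow> ('e \<Rightarrow> real) \<Rightarrow> 'e graph_fun \<Rightarrow> 'e graph_fun \<Rightarrow> bool" where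
  "neg_laplacian G L f h \<longleftrightarrow>
     f \<in> laplacian_domain G L \<and>
     (\<forall>e \<in> arcs G. \<exists>g. has_weak_derivative (L e) (edge_deriv (L e) (f e)) g \<and>
                      (AE x in lebesgue_on {0..L e}. h e x = - g x))"


section \<open>Eigenvalues\<close>

definition graph_fun_scale :: "complex \<Rightarrow> 'e graph_fun \<Rightarrow> 'e graph_fun" where
  "graph_fun_scale c f = (\<lambda>e x. c * f e x)"

text \<open>\<open>graph_fun.dim\<close> below is the dimension over the complex numbers.\<close>

interpretation graph_fun: vector_space "graph_fun_scale :: complex \<Rightarrow> 'e graph_fun \<Rightarrow> 'e graph_fun"
  by unfold_locales (auto simp: graph_fun_scale_def fun_eq_iff algebra_simps)

definition eigenspace ::
    "('v, 'e) pre_digraph \<Rightarrow> ('e \<Rightarrow> real) \<Rightarrow> complex \<Rightarrow> 'e graph_fun set" where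
  "eigenspace G L z = {f. neg_laplacian G L f (graph_fun_scale z f)}"

definition is_eigenvalue :: "('v, 'e) pre_digraph \<Rightarrow> ('e \<Rightarrow> real) \<Rightarrow> real \<Rightarrow> bool" where
  "is_eigenvalue G L \<mu> \<longleftrightarrow> (\<exists>f \<in> eigenspace G L (complex_of_real \<mu>). f \<noteq> 0)"

definition multiplicity ::
    "('v, 'e) pre_digraph \<Rightarrow> ('e \<Rightarrow> real) \<Rightarrow> real \<Rightarrow> nat" where
  "multiplicity G L \<mu> = graph_fun.dim (eigenspace G L (complex_of_real \<mu>))"

definition eigenvalue_count ::
    "('v, 'e) pre_digraph \<Rightarrow> ('e \<Rightarrow> real) \<Rightarrow> real \<Rightarrow> nat" where
  "eigenvalue_count G L t = (\<Sum>\<mu> | is_eigenvalue G L \<mu> \<and> \<mu> \<le> t. multiplicity G L \<mu>)"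

text \<open>
  The \<open>k\<close>-th eigenvalue, \<open>k \<ge> 1\<close>, is the least \<open>t\<close> such that at least
  \<open>k\<close> eigenvalues, counted with multiplicities, are at most \<open>t\<close>. The lemma
  \<open>lists_eigenvalues_unique\<close> shows that this is the \<open>k\<close>-th entry of
  the nondecreasing list of all eigenvalues with multiplicities.
\<close>

definition eigenval :: "('v, 'e) pre_digraph \<Rightarrow> ('e \<Rightarrow> real) \<Rightarrow> nat \<Rightarrow> real" where
  "eigenval G L k = Inf {t. k \<le> eigenvalue_count G L t}"

definition lists_eigenvalues ::
    "('v, 'e) pre_digraph \<Rightarrow> ('e \<Rightarrow> real) \<Rightarrow> (nat \<Rightarrow> real) \<Rightarrow> bool" where
  "lists_eigenvalues G L lam \<longleftrightarrow>
     mono_on {1..} lam \<and> lam ` {1..} = {\<mu>. is_eigenvalue G L \<mu>} \<and>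
     (\<forall>\<mu>. finite {k \<in> {1..}. lam k = \<mu>} \<and> card {k \<in> {1..}. lam k = \<mu>} = multiplicity G L \<mu>)"

lemma lists_eigenvalues_unique:
  assumes lam: "lists_eigenvalues G L lam" and n: "1 \<le> n"
  shows "eigenval G L n = lam n"
proof -
  have mono: "mono_on {1..} lam"
    and img: "lam ` {1..} = {\<mu>. is_eigenvalue G L \<mu>}"
    and fin: "\<And>\<mu>. finite {k \<in> {1..}. lam k = \<mu>}"
    and mult: "\<And>\<mu>. multiplicity G L \<mu> = card {k \<in> {1..}. lam k = \<mu>}"
    using lam unfolding lists_eigenvalues_def by auto
  have count: "eigenvalue_count G L t = card {k \<in> {1..}. lam k \<le> t}"
    if t: "t \<le> lam n" for t
  proof -
    have "{k \<in> {1..}. lam k \<le> t} \<subseteq> {..n} \<union> {k \<in> {1..}. lam k = lam n}"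
    proof
      fix k assume k: "k \<in> {k \<in> {1..}. lam k \<le> t}"
      show "k \<in> {..n} \<union> {k \<in> {1..}. lam k = lam n}"
      proof (cases "k \<le> n")
        case False
        then have "lam n \<le> lam k"
          using n k by (intro mono_onD[OF mono]) auto
        then show ?thesis
          using k t by auto
      qed simp
    qed
    then have fk: "finite {k \<in> {1..}. lam k \<le> t}"
      by (rule finite_subset) (use fin in simp)
    have ev: "{\<mu>. is_eigenvalue G L \<mu> \<and> \<mu> \<le> t} = lam ` {k \<in> {1..}. lam k \<le> t}"
      using img by auto
    have "eigenvalue_count G L t = (\<Sum>\<mu> \<in> lam ` {k \<in> {1..}. lam k \<le> t}. card {k \<in> {1..}. lam k = \<mu>})"
      unfolding eigenvalue_count_def ev mult ..
    also have "\<dots> = card (\<Union>\<mu> \<in> lam ` {k \<in> {1..}. lam k \<le> t}. {k \<in> {1..}. lam k = \<mu>})"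
      by (rule card_UN_disjoint[symmetric]) (use fk fin in auto)
    also have "(\<Union>\<mu> \<in> lam ` {k \<in> {1..}. lam k \<le> t}. {k \<in> {1..}. lam k = \<mu>}) = {k \<in> {1..}. lam k \<le> t}"
      by auto
    finally show ?thesis .
  qed
  have "finite {k \<in> {1..}. lam k \<le> lam n}"
  proof (rule finite_subset)
    show "{k \<in> {1..}. lam k \<le> lam n} \<subseteq> {..n} \<union> {k \<in> {1..}. lam k = lam n}"
    proof
      fix k assume k: "k \<in> {k \<in> {1..}. lam k \<le> lam n}"
      show "k \<in> {..n} \<union> {k \<in> {1..}. lam k = lam n}"
      proof (cases "k \<le> n")
        case False
        then have "lam n \<le> lam k"
          using n k by (intro mono_onD[OF mono]) auto
        then show ?thesis
          using k by auto
      qed simp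
    qed
  qed (use fin in simp)
  moreover have "{1..n} \<subseteq> {k \<in> {1..}. lam k \<le> lam n}"
    using n by (auto intro!: mono_onD[OF mono])
  ultimately have "card {1..n} \<le> card {k \<in> {1..}. lam k \<le> lam n}"
    by (rule card_mono)
  then have mem: "n \<le> eigenvalue_count G L (lam n)"
    by (simp add: count)
  have low: "lam n \<le> t" if t: "n \<le> eigenvalue_count G L t" for t
  proof (rule ccontr)
    assume less: "\<not> lam n \<le> t"
    have "{k \<in> {1..}. lam k \<le> t} \<subseteq> {1..<n}"
    proof
      fix k assume k: "k \<in> {k \<in> {1..}. lam k \<le> t}"
      have "\<not> n \<le> k"
      proof
        assume "n \<le> k"
        then have "lam n \<le> lam k"
          using n by (intro mono_onD[OF mono]) auto
        then show False
          using k less by auto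
      qed
      then show "k \<in> {1..<n}"
        using k by auto
    qed
    then have "card {k \<in> {1..}. lam k \<le> t} \<le> card {1..<n}"
      by (rule card_mono[rotated]) simp
    then show False
      using t less n by (simp add: count)
  qed
  show ?thesis
    unfolding eigenval_def by (rule cInf_eq_minimum) (use mem low in auto)
qed

end

theory Submission
  imports Defs
begin

text \<open>
  Let \<open>e\<close> be a longest edge and \<open>l\<close> its length. The proof exhibits \<open>k + 1\<close>
  \<^emph>\<open>distinct\<close> eigenvalues in \<open>[0, (k \<pi> / l)\<^sup>2]\<close>. If \<open>e\<close> is the only edge, they
  are the squares of the frequencies \<open>j \<pi> / l\<close> of \<open>cos (j \<pi> x / l)\<close> for \<open>j \<le> k\<close>.

  Otherwise cutting the tree at \<open>e\<close> leaves two trees rooted at the ends of \<open>e\<close>, at least one of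
  which has an edge (\<open>tree_decomposition_at_arc\<close>). For every frequency \<open>s > 0\<close> a rooted tree
  carries a solution of \<open>- f'' = s\<^sup>2 f\<close> that satisfies all vertex conditions except the
  Kirchhoff condition at the root. Let \<open>X s\<close> be its value at the root and \<open>- s * Y s\<close> its normal
  derivative there. Then \<open>X + iY\<close> plays the role of the phase of the wave that leaves the tree
  through its root. Following an edge of length \<open>l\<close> multiplies it by \<open>exp (i s l)\<close>, and joining two
  branches at a vertex adds the tangents of their phases; both operations make the phase increase
  with \<open>s\<close> (\<open>rooted_tree_root_data\<close>). For the whole tree the remaining Kirchhoff condition says
  that the imaginary part of \<open>(X\<^sub>1 + iY\<^sub>1) (X\<^sub>2 + iY\<^sub>2) exp (i s l)\<close> vanishes. On an interval of length
  \<open>\<pi> / l\<close> the last factor alone turns by \<open>\<pi>\<close>, and the two branches turn the product a little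
  further, so the imaginary part vanishes inside every open interval of that length
  (\<open>phase_gap\<close>). Where \<open>X\<close> and \<open>Y\<close> vanish together the phase is undefined, but then several branches
  have a node at a common vertex, and a combination of their waves is an eigenfunction that
  vanishes on the rest of the tree (\<open>trapped_wave\<close>). Thus each interval
  \<open>((j - 1) \<pi> / l, j \<pi> / l)\<close> contains a frequency (\<open>frequency_in_window\<close>), and together with the
  constant functions this yields \<open>k + 1\<close> eigenvalues that are strictly smaller than
  \<open>(k \<pi> / l)\<^sup>2\<close>. Two edges whose lengths have an irrational quotient are different, so this second
  case applies and the inequality is strict.

  A bound for the \<open>(k + 1)\<close>-st eigenvalue follows once the counting function is known to be
  well-behaved: there is no negative eigenvalue (an energy identity), every eigenspace is nonzero
  and of finite dimension (a solution is determined by its initial data on the edges), and only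
  finitely many eigenvalues lie below a given bound. The last fact is a compactness argument:
  normalised eigenfunctions of infinitely many eigenvalues would accumulate at a nonzero function,
  although they are mutually orthogonal.
\<close>


section \<open>Decomposing a tree at an edge\<close>

definition joins :: "('v, 'e) pre_digraph \<Rightarrow> 'e \<Rightarrow> 'v \<Rightarrow> 'v \<Rightarrow> bool" where
  "joins G e v w \<longleftrightarrow> tail G e = v \<and> head G e = w \<or> tail G e = w \<and> head G e = v"

text \<open>
  Grafting one branch at a time, by a single edge at the root, makes every recursion below binary;
  requiring disjoint vertex sets is what excludes cycles.
\<close>

inductive rooted_tree ::
    "('v, 'e) pre_digraph \<Rightarrow> 'v \<Rightarrow> 'v set \<Rightarrow> 'e set \<Rightarrow> bool" for G where
  single: "rooted_tree G v {v} {}"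
| graft: "\<lbrakk>rooted_tree G v U A; rooted_tree G w W B; U \<inter> W = {}; joins G e v w\<rbrakk>
    \<Longrightarrow> rooted_tree G v (U \<union> W) (insert e (A \<union> B))"

lemma rooted_tree_root: "rooted_tree G v U A \<Longrightarrow> v \<in> U"
  by (induction rule: rooted_tree.induct) auto

lemma rooted_tree_ends: "rooted_tree G v U A \<Longrightarrow> e \<in> A \<Longrightarrow> tail G e \<in> U \<and> head G e \<in> U"
  by (induction arbitrary: e rule: rooted_tree.induct) (auto simp: joins_def dest: rooted_tree_root)

lemma rooted_tree_finite: "rooted_tree G v U A \<Longrightarrow> finite U \<and> finite A"
  by (induction rule: rooted_tree.induct) auto

text \<open>
  \<open>graft\<close> extends a tree at its root only. A leaf can be attached at any vertex by descending to
  the branch that contains the vertex, which is how a spanning tree is grown below.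
\<close>

lemma rooted_tree_add_leaf:
  assumes "rooted_tree G v U A" "z \<in> U" "z' \<notin> U" "joins G e z z'"
  shows "rooted_tree G v (insert z' U) (insert e A)"
  using assms
proof (induction rule: rooted_tree.induct)
  case (single v)
  have "rooted_tree G v ({v} \<union> {z'}) (insert e ({} \<union> {}))"
    by (rule rooted_tree.graft) (use single in \<open>auto intro: rooted_tree.single\<close>)
  then show ?case by (simp add: insert_commute)
next
  case (graft v U A w W B d)
  show ?case
  proof (cases "z \<in> U")
    case True
    then have "rooted_tree G v (insert z' U \<union> W) (insert d (insert e A \<union> B))"
      using graft by (intro rooted_tree.graft[of G v _ _ w]) auto
    then show ?thesis by (simp add: insert_commute)
  next
    case False
    then have "rooted_tree G v (U \<union> insert z' W) (insert d (A \<union> insert e B))"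
      using graft by (intro rooted_tree.graft[of G v _ _ w]) auto
    then show ?thesis by (simp add: insert_commute)
  qed
qed

fun trav_path :: "('v, 'e) pre_digraph \<Rightarrow> 'v \<Rightarrow> ('e \<times> bool) list \<Rightarrow> 'v \<Rightarrow> bool" where
  "trav_path G p [] q \<longleftrightarrow> p = q"
| "trav_path G p (d # ds) q \<longleftrightarrow> trav_start G d = p \<and> trav_path G (trav_end G d) ds q"

lemma trav_path_append:
  "trav_path G p (xs @ ys) q \<longleftrightarrow> (\<exists>r. trav_path G p xs r \<and> trav_path G r ys q)"
  by (induction xs arbitrary: p) auto

lemma trav_path_nth:
  assumes "trav_path G p ds q" "i < length ds"
  shows "trav_end G (ds ! i) = (if Suc i < length ds then trav_start G (ds ! Suc i) else q)"
  using assms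
proof (induction ds arbitrary: p i)
  case (Cons d ds)
  then show ?case by (cases i; cases ds) auto
qed simp

text \<open>
  The final vertex is kept apart from the starting vertices, so that one further traversal out of
  \<open>q\<close> still gives a list with distinct starting vertices, as \<open>undirected_cycle\<close> demands.
\<close>

definition simple_trav_path ::
    "('v, 'e) pre_digraph \<Rightarrow> 'v set \<Rightarrow> 'e set \<Rightarrow> 'v \<Rightarrow> ('e \<times> bool) list \<Rightarrow> 'v \<Rightarrow> bool" where
  "simple_trav_path G U A p ds q \<longleftrightarrow>
     trav_path G p ds q \<and> fst ` set ds \<subseteq> A \<and> trav_start G ` set ds \<subseteq> U - {q} \<and>
     distinct (map fst ds) \<and> distinct (map (trav_start G) ds)"

lemma simple_trav_path_cross:
  assumes xs: "simple_trav_path G U A p xs v" and ys: "simple_trav_path G W B w ys q"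
    and d: "trav_start G d = v" "trav_end G d = w"
    and disj: "U \<inter> W = {}" "A \<inter> B = {}" "fst d \<notin> A" "fst d \<notin> B" and mem: "v \<in> U" "q \<in> W"
  shows "simple_trav_path G (U \<union> W) (insert (fst d) (A \<union> B)) p (xs @ d # ys) q"
proof -
  have "trav_path G p (xs @ d # ys) q"
    using xs ys d by (auto simp: trav_path_append simple_trav_path_def)
  moreover have "distinct (map fst (xs @ d # ys))"
    using xs ys disj by (simp add: simple_trav_path_def) blast
  moreover have "distinct (map (trav_start G) (xs @ d # ys))"
    using xs ys disj d mem by (simp add: simple_trav_path_def) blast
  moreover have "fst ` set (xs @ d # ys) \<subseteq> insert (fst d) (A \<union> B)"
    using xs ys by (auto simp: simple_trav_path_def)
  moreover have "trav_start G ` set (xs @ d # ys) \<subseteq> U \<union> W - {q}"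
    using xs ys disj d mem by (simp add: simple_trav_path_def) blast
  ultimately show ?thesis unfolding simple_trav_path_def by blast
qed

lemma simple_trav_path_mono:
  "simple_trav_path G U A p xs q \<Longrightarrow> U \<subseteq> U' \<Longrightarrow> A \<subseteq> A' \<Longrightarrow> simple_trav_path G U' A' p xs q"
  unfolding simple_trav_path_def by blast

text \<open>
  A path between the two parts of a graft has to run through the grafting edge, so paths inside the
  parts are concatenated with a traversal of that edge.
\<close>

lemma rooted_tree_simple_trav_path:
  assumes "rooted_tree G v U A" "p \<in> U" "q \<in> U"
  shows "\<exists>ds. simple_trav_path G U A p ds q"
  using assms
proof (induction arbitrary: p q rule: rooted_tree.induct)
  case (single v)
  then have "simple_trav_path G {v} {} p [] q" by (simp add: simple_trav_path_def)
  then show ?case by blast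
next
  case (graft v U A w W B e)
  note ends = rooted_tree_ends[OF graft.hyps(1)] rooted_tree_ends[OF graft.hyps(2)]
  have vw: "v \<in> U" "w \<in> W"
    using graft.hyps by (auto dest: rooted_tree_root)
  have AB: "A \<inter> B = {}" using ends graft.hyps(3) by blast
  have e: "e \<notin> A" "e \<notin> B"
    using ends graft.hyps(3,4) vw unfolding joins_def by blast+
  obtain b where b: "trav_start G (e, b) = v" "trav_end G (e, b) = w"
    using graft.hyps(4) unfolding joins_def
    by (metis (mono_tags, opaque_lifting) fst_conv snd_conv trav_end_def trav_start_def)
  have b': "trav_start G (e, \<not> b) = w" "trav_end G (e, \<not> b) = v"
    using b by (auto simp: trav_start_def trav_end_def)
  consider "p \<in> U" "q \<in> U" | "p \<in> U" "q \<in> W" | "p \<in> W" "q \<in> U" | "p \<in> W" "q \<in> W"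
    using graft.prems by blast
  then show ?case
  proof cases
    case 1
    then show ?thesis using graft.IH(1) simple_trav_path_mono[of G U A p _ q "U \<union> W" "insert e (A \<union> B)"]
      by blast
  next
    case 2
    obtain xs where "simple_trav_path G U A p xs v" using graft.IH(1)[OF 2(1) vw(1)] by blast
    moreover obtain ys where "simple_trav_path G W B w ys q" using graft.IH(2)[OF vw(2) 2(2)] by blast
    ultimately show ?thesis
      using simple_trav_path_cross[of G U A p xs v W B w ys q "(e, b)"] b AB e vw graft.hyps(3) 2 by auto
  next
    case 3
    obtain xs where "simple_trav_path G W B p xs w" using graft.IH(2)[OF 3(1) vw(2)] by blast
    moreover obtain ys where "simple_trav_path G U A v ys q" using graft.IH(1)[OF vw(1) 3(2)] by blast
    ultimately show ?thesis
      using simple_trav_path_cross[of G W B p xs w U A v ys q "(e, \<not> b)"] b' AB e vw graft.hyps(3) 3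
      by (auto simp: Int_commute Un_commute)
  next
    case 4
    then show ?thesis using graft.IH(2) simple_trav_path_mono[of G W B p _ q "U \<union> W" "insert e (A \<union> B)"]
      by blast
  qed
qed

text \<open>
  An edge outside a tree closes the path between its ends to a cycle. A loop is covered: there the
  path is empty.
\<close>

lemma chord_closes_cycle:
  assumes "simple_trav_path G U A (head G e) ds (tail G e)" "e \<notin> A" "insert e A \<subseteq> arcs G"
  shows "undirected_cycle G (ds @ [(e, True)])"
proof -
  let ?p = "ds @ [(e, True)]"
  have path: "trav_path G (head G e) ?p (head G e)"
    using assms(1) by (auto simp: simple_trav_path_def trav_path_append trav_start_def trav_end_def)
  have start: "trav_start G (?p ! 0) = head G e"
    using path by (cases ds) auto
  have "trav_end G (?p ! i) = trav_start G (?p ! (Suc i mod length ?p))" if i: "i < length ?p" for i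
  proof (cases "Suc i < length ?p")
    case True
    then show ?thesis using trav_path_nth[OF path i] by simp
  next
    case False
    then have "Suc i = length ?p" using i by simp
    then have "Suc i mod length ?p = 0" by simp
    then show ?thesis using trav_path_nth[OF path i] False start by simp
  qed
  then show ?thesis
    using assms unfolding undirected_cycle_def simple_trav_path_def
    by (auto simp: trav_start_def)
qed

lemma (in fin_digraph) connected_crossing_arc:
  assumes conn: "Digraph_Component.connected G" and X: "x \<in> X" "x \<in> verts G" "y \<in> verts G" "y \<notin> X"
  shows "\<exists>e\<in>arcs G. \<exists>z z'. z \<in> X \<and> z' \<notin> X \<and> joins G e z z'"
proof (rule ccontr)
  assume none: "\<not> ?thesis"
  have "x \<rightarrow>\<^sup>*\<^bsub>mk_symmetric G\<^esub> y"
    using conn X unfolding connected_def strongly_connected_def by auto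
  then have "(x, y) \<in> rtrancl_on (verts G) (parcs (mk_symmetric G))"
    by (simp add: reachable_def)
  then have "y \<in> X"
  proof (induction rule: rtrancl_on_induct)
    case base
    then show ?case using X by simp
  next
    case (step u w)
    then show ?case using none by (auto simp: parcs_mk_symmetric joins_def)
  qed
  then show False using X by simp
qed

text \<open>
  As long as the two trees miss a vertex, connectedness provides an edge that leaves their union, and
  its far end becomes a leaf of one of them.
\<close>

lemma (in fin_digraph) grow_rooted_trees:
  assumes conn: "Digraph_Component.connected G"
  shows "rooted_tree G x U A \<Longrightarrow> rooted_tree G y W B \<Longrightarrow> U \<inter> W = {} \<Longrightarrow> U \<union> W \<subseteq> verts G
    \<Longrightarrow> A \<union> B \<subseteq> arcs G \<Longrightarrow>
    \<exists>U W A B. rooted_tree G x U A \<and> rooted_tree G y W B \<and> U \<inter> W = {} \<and> U \<union> W = verts G \<and>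
      A \<union> B \<subseteq> arcs G"
proof (induction "card (verts G - (U \<union> W))" arbitrary: U W A B rule: less_induct)
  case less
  show ?case
  proof (cases "U \<union> W = verts G")
    case True
    then show ?thesis using less.prems by blast
  next
    case False
    then obtain r where r: "r \<in> verts G" "r \<notin> U \<union> W" using less.prems by blast
    have "x \<in> U" using less.prems(1) by (rule rooted_tree_root)
    then obtain e z z' where e: "e \<in> arcs G" "z \<in> U \<union> W" "z' \<notin> U \<union> W" "joins G e z z'"
      using connected_crossing_arc[OF conn, of x "U \<union> W" r] r less.prems(4) by blast
    have z': "z' \<in> verts G" using e by (auto simp: joins_def)
    have fin: "finite (verts G - (U \<union> W))" by auto
    show ?thesis
    proof (cases "z \<in> U")
      case True
      have "verts G - (insert z' U \<union> W) \<subset> verts G - (U \<union> W)" using z' e by blast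
      with fin have "card (verts G - (insert z' U \<union> W)) < card (verts G - (U \<union> W))"
        by (rule psubset_card_mono)
      moreover have "rooted_tree G x (insert z' U) (insert e A)"
        using rooted_tree_add_leaf[OF less.prems(1) True] e by blast
      moreover have "insert z' U \<inter> W = {}" "insert z' U \<union> W \<subseteq> verts G" "insert e A \<union> B \<subseteq> arcs G"
        using less.prems e z' by auto
      ultimately show ?thesis using less.hyps less.prems(2) by blast
    next
      case False
      have "verts G - (U \<union> insert z' W) \<subset> verts G - (U \<union> W)" using z' e by blast
      with fin have "card (verts G - (U \<union> insert z' W)) < card (verts G - (U \<union> W))"
        by (rule psubset_card_mono)
      moreover have "rooted_tree G y (insert z' W) (insert e B)"
        using rooted_tree_add_leaf[OF less.prems(2)] False e by blast
      moreover have "U \<inter> insert z' W = {}" "U \<union> insert z' W \<subseteq> verts G" "A \<union> insert e B \<subseteq> arcs G"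
        using less.prems e z' by auto
      ultimately show ?thesis using less.hyps less.prems(1) by blast
    qed
  qed
qed

text \<open>
  Growing the two trees from the ends of \<open>e\<close> gives a spanning tree through \<open>e\<close>. It contains every
  edge, because any other edge would close a cycle.
\<close>

lemma (in fin_digraph) tree_decomposition_at_arc:
  assumes tree: "undirected_tree G" and e: "e \<in> arcs G"
  obtains U W A B where "rooted_tree G (tail G e) U A" "rooted_tree G (head G e) W B"
    "U \<inter> W = {}" "U \<union> W = verts G" "arcs G = insert e (A \<union> B)"
proof -
  have acyclic: "\<not> undirected_cycle G p" for p using tree by (auto simp: undirected_tree_def)
  have loop: "tail G e \<noteq> head G e"
  proof
    assume "tail G e = head G e"
    then have "simple_trav_path G {} {} (head G e) [] (tail G e)" by (simp add: simple_trav_path_def)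
    then show False using chord_closes_cycle[of G "{}" "{}" e "[]"] e acyclic by auto
  qed
  obtain U W A B where T: "rooted_tree G (tail G e) U A" "rooted_tree G (head G e) W B"
    "U \<inter> W = {}" "U \<union> W = verts G" "A \<union> B \<subseteq> arcs G"
    using grow_rooted_trees[OF _ rooted_tree.single rooted_tree.single, of "tail G e" "head G e"]
      tree e loop by (auto simp: undirected_tree_def)
  have whole: "rooted_tree G (tail G e) (U \<union> W) (insert e (A \<union> B))"
    by (rule rooted_tree.graft[OF T(1,2,3)]) (simp add: joins_def)
  have "d \<in> insert e (A \<union> B)" if d: "d \<in> arcs G" for d
  proof (rule ccontr)
    assume new: "d \<notin> insert e (A \<union> B)"
    have "tail G d \<in> U \<union> W" "head G d \<in> U \<union> W" using d T(4) by auto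
    then obtain ds where "simple_trav_path G (U \<union> W) (insert e (A \<union> B)) (head G d) ds (tail G d)"
      using rooted_tree_simple_trav_path[OF whole] by blast
    then show False using chord_closes_cycle new d e T(5) acyclic by (metis insert_subset)
  qed
  then have "arcs G = insert e (A \<union> B)" using T(5) e by blast
  then show thesis using that T by blast
qed


section \<open>Phases of waves on rooted trees\<close>

text \<open>
  On the edge \<open>e\<close> the wave with coefficients \<open>a e\<close> and \<open>b e\<close> is \<open>a cos (s x) + b sin (s x)\<close>. The flux
  at \<open>u\<close> is the contribution of the edges in \<open>A\<close> to the normal derivative at \<open>u\<close>, divided by \<open>s\<close>.
\<close>

definition flux ::
    "('v, 'e) pre_digraph \<Rightarrow> ('e \<Rightarrow> real) \<Rightarrow> real \<Rightarrow> 'e set \<Rightarrow> ('e \<Rightarrow> real) \<Rightarrow> ('e \<Rightarrow> real) \<Rightarrow> 'v \<Rightarrow> real" where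
  "flux G L s A a b u =
     (\<Sum>e\<in>A. (if head G e = u then b e * cos (s * L e) - a e * sin (s * L e) else 0) -
            (if tail G e = u then b e else 0))"

text \<open>
  The Kirchhoff condition at the root \<open>v\<close> is left open, because the rest of the graph is attached
  there.
\<close>

definition wave ::
    "('v, 'e) pre_digraph \<Rightarrow> ('e \<Rightarrow> real) \<Rightarrow> real \<Rightarrow> 'v \<Rightarrow> 'v set \<Rightarrow> 'e set \<Rightarrow>
     ('v \<Rightarrow> real) \<Rightarrow> ('e \<Rightarrow> real) \<Rightarrow> ('e \<Rightarrow> real) \<Rightarrow> bool" where
  "wave G L s v U A \<phi> a b \<longleftrightarrow>
     (\<forall>e\<in>A. \<phi> (tail G e) = a e \<and> \<phi> (head G e) = a e * cos (s * L e) + b e * sin (s * L e)) \<and>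
     (\<forall>u\<in>U - {v}. flux G L s A a b u = 0)"

text \<open>
  Such a wave can be extended by zero to any graph in which the tree is attached at its root only,
  so for \<open>s \<noteq> 0\<close> it makes \<open>s\<^sup>2\<close> an eigenvalue of all these graphs.
\<close>

definition trapped_wave ::
    "('v, 'e) pre_digraph \<Rightarrow> ('e \<Rightarrow> real) \<Rightarrow> real \<Rightarrow> 'v \<Rightarrow> 'v set \<Rightarrow> 'e set \<Rightarrow> bool" where
  "trapped_wave G L s v U A \<longleftrightarrow>
     (\<exists>\<phi> a b. wave G L s v U A \<phi> a b \<and> \<phi> v = 0 \<and> flux G L s A a b v = 0 \<and>
              (\<exists>e\<in>A. a e \<noteq> 0 \<or> b e \<noteq> 0))"

lemma flux_outside:
  assumes "rooted_tree G v U A" "u \<notin> U"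
  shows "flux G L s A a b u = 0"
  unfolding flux_def using rooted_tree_ends[OF assms(1)] assms(2) by (intro sum.neutral) auto

lemma flux_cong:
  "(\<And>e. e \<in> A \<Longrightarrow> a e = k * a' e \<and> b e = k * b' e) \<Longrightarrow>
    flux G L s A a b u = k * flux G L s A a' b' u"
  unfolding flux_def sum_distrib_left by (intro sum.cong) (auto simp: algebra_simps)

text \<open>
  Given waves on the two parts, their multiples by \<open>p\<close> and \<open>q\<close> fit together: the wave on the
  connecting edge is prescribed by its value \<open>q * \<phi>2 w\<close> at \<open>w\<close> and the Kirchhoff condition at \<open>w\<close>,
  and \<open>match\<close> says that it arrives at \<open>v\<close> with the value of the other wave.
\<close>

lemma graft_wave:
  fixes L :: "'e \<Rightarrow> real"
  assumes TA: "rooted_tree G v U A" and TB: "rooted_tree G w W B" and UW: "U \<inter> W = {}"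
    and e: "joins G e v w"
    and wA: "wave G L s v U A \<phi>1 a1 b1" and wB: "wave G L s w W B \<phi>2 a2 b2"
    and y: "y = flux G L s B a2 b2 w"
    and match: "p * \<phi>1 v = q * (\<phi>2 w * cos (s * L e) + y * sin (s * L e))"
  shows "\<exists>\<phi> a b. wave G L s v (U \<union> W) (insert e (A \<union> B)) \<phi> a b \<and> \<phi> v = p * \<phi>1 v \<and>
    flux G L s (insert e (A \<union> B)) a b v =
      p * flux G L s A a1 b1 v + q * (y * cos (s * L e) - \<phi>2 w * sin (s * L e)) \<and>
    (\<forall>d\<in>A. a d = p * a1 d \<and> b d = p * b1 d) \<and> (\<forall>d\<in>B. a d = q * a2 d \<and> b d = q * b2 d)"
proof -
  define c where "c = cos (s * L e)"
  define n where "n = sin (s * L e)"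
  have cn: "c * c + n * n = 1" unfolding c_def n_def
    by (metis power2_eq_square sin_cos_squared_add2)
  \<comment> \<open>the orientation of \<open>e\<close> decides in which direction the prescribed wave is parametrised\<close>
  define fwd where "fwd \<longleftrightarrow> tail G e = w"
  define ae where "ae = (if fwd then q * \<phi>2 w else q * (\<phi>2 w * c + y * n))"
  define be where "be = (if fwd then q * y else q * (\<phi>2 w * n - y * c))"
  define a where "a d = (if d = e then ae else if d \<in> A then p * a1 d else q * a2 d)" for d
  define b where "b d = (if d = e then be else if d \<in> A then p * b1 d else q * b2 d)" for d
  define \<phi> where "\<phi> u = (if u \<in> U then p * \<phi>1 u else q * \<phi>2 u)" for u
  have vw: "v \<in> U" "w \<in> W" "v \<notin> W" "w \<notin> U" "v \<noteq> w"
    using rooted_tree_root[OF TA] rooted_tree_root[OF TB] UW by auto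
  note endsA = rooted_tree_ends[OF TA] and endsB = rooted_tree_ends[OF TB]
  have AB: "A \<inter> B = {}" using endsA endsB UW by blast
  have eA: "e \<notin> A" "e \<notin> B" using endsA endsB e vw unfolding joins_def by blast+
  have finAB: "finite A" "finite B" using rooted_tree_finite[OF TA] rooted_tree_finite[OF TB] by auto
  have coefA: "a d = p * a1 d \<and> b d = p * b1 d" if "d \<in> A" for d
    using that eA by (auto simp: a_def b_def)
  have coefB: "a d = q * a2 d \<and> b d = q * b2 d" if "d \<in> B" for d
    using that eA AB by (auto simp: a_def b_def)
  have ends_e: "fwd \<and> tail G e = w \<and> head G e = v \<or> \<not> fwd \<and> tail G e = v \<and> head G e = w"
    using e vw unfolding joins_def fwd_def by auto
  have flux_e: "(if head G e = u then b e * c - a e * n else 0) - (if tail G e = u then b e else 0) =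
      (if u = v then q * (y * c - \<phi>2 w * n) else 0) - (if u = w then q * y else 0)" for u
  proof (cases fwd)
    case True
    then show ?thesis using ends_e vw by (auto simp: a_def b_def ae_def be_def algebra_simps)
  next
    case False
    have "q * (\<phi>2 w * n - y * c) * c - q * (\<phi>2 w * c + y * n) * n = - (q * y) * (c * c + n * n)"
      by (simp add: algebra_simps)
    then show ?thesis using False ends_e vw cn by (auto simp: a_def b_def ae_def be_def algebra_simps)
  qed
  have flux_add: "flux G L s (insert e (A \<union> B)) a b u =
      (if u = v then q * (y * c - \<phi>2 w * n) else 0) - (if u = w then q * y else 0) +
      p * flux G L s A a1 b1 u + q * flux G L s B a2 b2 u" for u
  proof -
    have "flux G L s (insert e (A \<union> B)) a b u =
        ((if head G e = u then b e * c - a e * n else 0) - (if tail G e = u then b e else 0)) +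
        flux G L s A a b u + flux G L s B a b u"
      unfolding flux_def c_def n_def using finAB AB eA by (simp add: sum.union_disjoint)
    also have "flux G L s A a b u = p * flux G L s A a1 b1 u"
      using coefA by (rule flux_cong)
    also have "flux G L s B a b u = q * flux G L s B a2 b2 u"
      using coefB by (rule flux_cong)
    finally show ?thesis using flux_e by simp
  qed
  have fluxW: "flux G L s A a1 b1 u = 0" if "u \<in> W" for u
    using flux_outside[OF TA] that UW by blast
  have fluxU: "flux G L s B a2 b2 u = 0" if "u \<in> U" for u
    using flux_outside[OF TB] that UW by blast
  have "wave G L s v (U \<union> W) (insert e (A \<union> B)) \<phi> a b"
    unfolding wave_def
  proof (intro conjI ballI)
    fix d assume d: "d \<in> insert e (A \<union> B)"
    consider "d \<in> A" | "d \<in> B" | "d = e" using d by blast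
    then have "\<phi> (tail G d) = a d \<and> \<phi> (head G d) = a d * cos (s * L d) + b d * sin (s * L d)"
    proof cases
      case 1
      then show ?thesis using wA endsA coefA
        by (auto simp: wave_def \<phi>_def algebra_simps)
    next
      case 2
      then have "tail G d \<notin> U" "head G d \<notin> U" using endsB UW by blast+
      then show ?thesis using wB 2 coefB by (auto simp: wave_def \<phi>_def algebra_simps)
    next
      case 3
      have m: "p * \<phi>1 v = q * (\<phi>2 w * c + y * n)" using match c_def n_def by simp
      show ?thesis
      proof (cases fwd)
        case True
        then show ?thesis using m 3 ends_e vw
          by (auto simp: \<phi>_def a_def b_def ae_def be_def algebra_simps simp flip: c_def n_def)
      next
        case False
        have "q * (\<phi>2 w * c + y * n) * c + q * (\<phi>2 w * n - y * c) * n = q * \<phi>2 w * (c * c + n * n)"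
          by (simp add: algebra_simps)
        then have "q * \<phi>2 w = ae * c + be * n" using cn False by (simp add: ae_def be_def)
        then show ?thesis using m False 3 ends_e vw
          by (auto simp: \<phi>_def a_def b_def ae_def simp flip: c_def n_def)
      qed
    qed
    then show "\<phi> (tail G d) = a d" "\<phi> (head G d) = a d * cos (s * L d) + b d * sin (s * L d)"
      by blast+
  next
    fix u assume u: "u \<in> (U \<union> W) - {v}"
    show "flux G L s (insert e (A \<union> B)) a b u = 0"
    proof (cases "u \<in> U")
      case True
      then show ?thesis using u wA fluxU vw by (auto simp: flux_add wave_def)
    next
      case False
      then show ?thesis using u wB fluxW vw y by (cases "u = w") (auto simp: flux_add wave_def)
    qed
  qed
  moreover have "\<phi> v = p * \<phi>1 v" using vw by (simp add: \<phi>_def)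
  moreover have "flux G L s (insert e (A \<union> B)) a b v =
      p * flux G L s A a1 b1 v + q * (y * cos (s * L e) - \<phi>2 w * sin (s * L e))"
    using vw fluxU[of v] by (simp add: flux_add c_def n_def)
  ultimately show ?thesis using coefA coefB by blast
qed

text \<open>
  \<open>X s\<close> is the root value and \<open>- Y s\<close> the flux at the root of a wave on the tree, chosen for all
  \<open>s\<close> at once. At a common zero of \<open>X\<close> and \<open>Y\<close> the chosen wave may be identically zero; the second
  clause then supplies a genuine one.
\<close>

definition root_data ::
    "('v, 'e) pre_digraph \<Rightarrow> ('e \<Rightarrow> real) \<Rightarrow> 'v \<Rightarrow> 'v set \<Rightarrow> 'e set \<Rightarrow> (real \<Rightarrow> real) \<Rightarrow> (real \<Rightarrow> real) \<Rightarrow> bool" where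
  "root_data G L v U A X Y \<longleftrightarrow>
     (\<forall>s. (\<exists>\<phi> a b. wave G L s v U A \<phi> a b \<and> \<phi> v = X s \<and> flux G L s A a b v = - Y s) \<and>
          (X s = 0 \<and> Y s = 0 \<longrightarrow> trapped_wave G L s v U A))"

text \<open>
  \<open>X Y' - Y X'\<close> is the derivative of the argument of \<open>X + iY\<close>, multiplied by \<open>X\<^sup>2 + Y\<^sup>2\<close>. Zeros of
  \<open>X + iY\<close> have to be admitted, as they occur at the frequencies of trapped waves.
\<close>

definition phase_increasing :: "(real \<Rightarrow> real) \<Rightarrow> (real \<Rightarrow> real) \<Rightarrow> bool" where
  "phase_increasing X Y \<longleftrightarrow>
     (\<exists>X' Y'. \<forall>s. (X has_real_derivative X' s) (at s) \<and> (Y has_real_derivative Y' s) (at s) \<and>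
        (X s \<noteq> 0 \<or> Y s \<noteq> 0 \<longrightarrow> X s * Y' s - Y s * X' s > 0))"

text \<open>
  Real and imaginary part of \<open>(X + iY) exp (i l s)\<close>, the data of a wave after it has travelled
  along an edge of length \<open>l\<close>.
\<close>

definition rotX :: "real \<Rightarrow> (real \<Rightarrow> real) \<Rightarrow> (real \<Rightarrow> real) \<Rightarrow> real \<Rightarrow> real" where
  "rotX l X Y s = X s * cos (s * l) - Y s * sin (s * l)"

definition rotY :: "real \<Rightarrow> (real \<Rightarrow> real) \<Rightarrow> (real \<Rightarrow> real) \<Rightarrow> real \<Rightarrow> real" where
  "rotY l X Y s = X s * sin (s * l) + Y s * cos (s * l)"

lemma rot_norm: "(rotX l X Y s)\<^sup>2 + (rotY l X Y s)\<^sup>2 = (X s)\<^sup>2 + (Y s)\<^sup>2"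
proof -
  have "(rotX l X Y s)\<^sup>2 + (rotY l X Y s)\<^sup>2 =
      ((X s)\<^sup>2 + (Y s)\<^sup>2) * ((sin (s * l))\<^sup>2 + (cos (s * l))\<^sup>2)"
    unfolding rotX_def rotY_def by algebra
  then show ?thesis by simp
qed

lemma rot_eq_0_iff: "rotX l X Y s = 0 \<and> rotY l X Y s = 0 \<longleftrightarrow> X s = 0 \<and> Y s = 0"
  using rot_norm[of l X Y s] by (metis sum_power2_eq_zero_iff)

text \<open>
  The wave of the branch arrives at \<open>v\<close> with data \<open>(x, y)\<close> obtained by rotation. Scaling the two
  waves by \<open>x\<close> and \<open>X1\<close> makes the root values agree, and the fluxes add up. If the new data vanish,
  either a part already has a trapped wave, or both waves have a node at \<open>v\<close> with nonzero fluxes;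
  in the latter case a combination of the two waves balances the fluxes and is trapped.
\<close>

lemma root_data_graft:
  assumes TA: "rooted_tree G v U A" and TB: "rooted_tree G w W B" and UW: "U \<inter> W = {}"
    and e: "joins G e v w"
    and dA: "root_data G L v U A X1 Y1" and dB: "root_data G L w W B X2 Y2"
  shows "root_data G L v (U \<union> W) (insert e (A \<union> B))
    (\<lambda>s. X1 s * rotX (L e) X2 Y2 s) (\<lambda>s. Y1 s * rotX (L e) X2 Y2 s + X1 s * rotY (L e) X2 Y2 s)"
  unfolding root_data_def
proof (intro allI conjI impI)
  fix s
  let ?x = "rotX (L e) X2 Y2 s" and ?y = "rotY (L e) X2 Y2 s"
  let ?wave = "wave G L s v (U \<union> W) (insert e (A \<union> B))"
  let ?flux = "flux G L s (insert e (A \<union> B))"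
  obtain \<phi>1 a1 b1 where w1: "wave G L s v U A \<phi>1 a1 b1" "\<phi>1 v = X1 s" "flux G L s A a1 b1 v = - Y1 s"
    using dA unfolding root_data_def by blast
  obtain \<phi>2 a2 b2 where w2: "wave G L s w W B \<phi>2 a2 b2" "\<phi>2 w = X2 s" "flux G L s B a2 b2 w = - Y2 s"
    using dB unfolding root_data_def by blast
  have combine: "\<exists>\<phi> a b. ?wave \<phi> a b \<and> \<phi> v = p * X1 s \<and> ?flux a b v = - (p * Y1 s + q * ?y) \<and>
      (\<forall>d\<in>A. a d = p * a1 d \<and> b d = p * b1 d) \<and> (\<forall>d\<in>B. a d = q * a2 d \<and> b d = q * b2 d)"
    if "p * X1 s = q * ?x" for p q
  proof -
    have m: "p * \<phi>1 v = q * (\<phi>2 w * cos (s * L e) + - Y2 s * sin (s * L e))"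
      using that w1 w2 by (simp add: rotX_def)
    have f: "p * flux G L s A a1 b1 v + q * (- Y2 s * cos (s * L e) - \<phi>2 w * sin (s * L e)) =
        - (p * Y1 s + q * ?y)"
      using w1 w2 by (simp add: rotY_def algebra_simps)
    show ?thesis
      using graft_wave[OF TA TB UW e w1(1) w2(1) w2(3)[symmetric] m] unfolding f w1(2) .
  qed
  show "\<exists>\<phi> a b. ?wave \<phi> a b \<and> \<phi> v = X1 s * ?x \<and> ?flux a b v = - (Y1 s * ?x + X1 s * ?y)"
    using combine[of "?x" "X1 s"] by (auto simp: algebra_simps)
  assume zero: "X1 s * ?x = 0 \<and> Y1 s * ?x + X1 s * ?y = 0"
  show "trapped_wave G L s v (U \<union> W) (insert e (A \<union> B))"
  proof (cases "X1 s = 0 \<and> Y1 s = 0")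
    case True
    then have "trapped_wave G L s v U A" using dA by (simp add: root_data_def)
    then obtain \<phi> a b where t: "wave G L s v U A \<phi> a b" "\<phi> v = 0" "flux G L s A a b v = 0"
      "\<exists>e\<in>A. a e \<noteq> 0 \<or> b e \<noteq> 0" unfolding trapped_wave_def by blast
    have m: "1 * \<phi> v = 0 * (\<phi>2 w * cos (s * L e) + - Y2 s * sin (s * L e))" using t by simp
    obtain \<phi>' a' b' where t': "?wave \<phi>' a' b'" "\<phi>' v = 0" "?flux a' b' v = 0"
      "\<forall>d\<in>A. a' d = a d \<and> b' d = b d"
      using graft_wave[OF TA TB UW e t(1) w2(1) w2(3)[symmetric] m] t(2,3) by auto
    from t(4) obtain d where d: "d \<in> A" "a d \<noteq> 0 \<or> b d \<noteq> 0" by blast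
    then have "d \<in> insert e (A \<union> B)" "a' d \<noteq> 0 \<or> b' d \<noteq> 0" using t'(4) by auto
    then show ?thesis unfolding trapped_wave_def using t'(1-3) by blast
  next
    case F1: False
    show ?thesis
    proof (cases "X2 s = 0 \<and> Y2 s = 0")
      case True
      then have "trapped_wave G L s w W B" using dB by (simp add: root_data_def)
      then obtain \<phi> a b where t: "wave G L s w W B \<phi> a b" "\<phi> w = 0" "flux G L s B a b w = 0"
        "\<exists>e\<in>B. a e \<noteq> 0 \<or> b e \<noteq> 0" unfolding trapped_wave_def by blast
      have m: "0 * \<phi>1 v = 1 * (\<phi> w * cos (s * L e) + 0 * sin (s * L e))" using t by simp
      obtain \<phi>' a' b' where t': "?wave \<phi>' a' b'" "\<phi>' v = 0" "?flux a' b' v = 0"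
        "\<forall>d\<in>B. a' d = a d \<and> b' d = b d"
        using graft_wave[OF TA TB UW e w1(1) t(1) t(3)[symmetric] m] t(2) by auto
      from t(4) obtain d where d: "d \<in> B" "a d \<noteq> 0 \<or> b d \<noteq> 0" by blast
      then have "d \<in> insert e (A \<union> B)" "a' d \<noteq> 0 \<or> b' d \<noteq> 0" using t'(4) by auto
      then show ?thesis unfolding trapped_wave_def using t'(1-3) by blast
    next
      case F2: False
      then have rot: "\<not> (?x = 0 \<and> ?y = 0)" using rot_eq_0_iff by blast
      have x: "?x = 0" "X1 s = 0" "?y \<noteq> 0" "Y1 s \<noteq> 0" using zero F1 rot by auto
      have "\<exists>d\<in>A. a1 d \<noteq> 0 \<or> b1 d \<noteq> 0"
      proof (rule ccontr)
        assume "\<not> ?thesis"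
        then have "flux G L s A a1 b1 v = 0" unfolding flux_def by (intro sum.neutral) auto
        then show False using w1(3) x by simp
      qed
      then obtain d where d: "d \<in> A" "a1 d \<noteq> 0 \<or> b1 d \<noteq> 0" by blast
      obtain \<phi> a b where t: "?wave \<phi> a b" "\<phi> v = 0" "?flux a b v = 0"
        "\<forall>d\<in>A. a d = ?y * a1 d \<and> b d = ?y * b1 d"
        using combine[of ?y "- Y1 s"] x(1,2) by auto
      then have "d \<in> insert e (A \<union> B)" "a d \<noteq> 0 \<or> b d \<noteq> 0" using d x(3) by auto
      then show ?thesis unfolding trapped_wave_def using t(1-3) by blast
    qed
  qed
qed

text \<open>
  The rotation adds \<open>l\<close> to the derivative of the phase. The alternative in the assumption is the data
  of a tree without edges, whose phase is constant; after an edge it does increase.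
\<close>

lemma phase_increasing_rot:
  assumes "phase_increasing X Y \<or> (X = (\<lambda>_. 1) \<and> Y = (\<lambda>_. 0))" "l > 0"
  shows "phase_increasing (rotX l X Y) (rotY l X Y)"
proof -
  obtain X' Y' where d: "\<And>s. (X has_real_derivative X' s) (at s)" "\<And>s. (Y has_real_derivative Y' s) (at s)"
    and pos: "\<And>s. X s * Y' s - Y s * X' s \<ge> 0"
  proof (cases "phase_increasing X Y")
    case True
    then obtain X' Y' where *: "\<And>s. (X has_real_derivative X' s) (at s) \<and> (Y has_real_derivative Y' s) (at s) \<and>
        (X s \<noteq> 0 \<or> Y s \<noteq> 0 \<longrightarrow> X s * Y' s - Y s * X' s > 0)"
      unfolding phase_increasing_def by blast
    have "X s * Y' s - Y s * X' s \<ge> 0" for s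
      using *[of s] by (cases "X s = 0 \<and> Y s = 0") auto
    then show thesis using that * by blast
  next
    case False
    then show thesis using that[of "\<lambda>_. 0" "\<lambda>_. 0"] assms(1) by auto
  qed
  let ?c = "\<lambda>s. cos (s * l)" and ?n = "\<lambda>s. sin (s * l)"
  define P where "P s = X' s * ?c s - Y' s * ?n s - l * rotY l X Y s" for s
  define Q where "Q s = X' s * ?n s + Y' s * ?c s + l * rotX l X Y s" for s
  have "(rotX l X Y has_real_derivative P s) (at s)" for s
    unfolding rotX_def[abs_def] P_def rotY_def
    by (rule derivative_eq_intros d refl)+ (simp add: algebra_simps)
  moreover have "(rotY l X Y has_real_derivative Q s) (at s)" for s
    unfolding rotY_def[abs_def] Q_def rotX_def
    by (rule derivative_eq_intros d refl)+ (simp add: algebra_simps)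
  moreover have "rotX l X Y s * Q s - rotY l X Y s * P s > 0"
    if nz: "rotX l X Y s \<noteq> 0 \<or> rotY l X Y s \<noteq> 0" for s
  proof -
    have "rotX l X Y s * Q s - rotY l X Y s * P s =
        (rotX l X Y s * (X' s * ?n s + Y' s * ?c s) - rotY l X Y s * (X' s * ?c s - Y' s * ?n s)) +
        l * ((rotX l X Y s)\<^sup>2 + (rotY l X Y s)\<^sup>2)"
      unfolding P_def Q_def by algebra
    also have "rotX l X Y s * (X' s * ?n s + Y' s * ?c s) - rotY l X Y s * (X' s * ?c s - Y' s * ?n s) =
        (X s * Y' s - Y s * X' s) * ((?n s)\<^sup>2 + (?c s)\<^sup>2)"
      unfolding rotX_def rotY_def by algebra
    finally have "rotX l X Y s * Q s - rotY l X Y s * P s =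
      (X s * Y' s - Y s * X' s) + l * ((rotX l X Y s)\<^sup>2 + (rotY l X Y s)\<^sup>2)" by simp
    moreover have "(rotX l X Y s)\<^sup>2 + (rotY l X Y s)\<^sup>2 > 0"
      using nz by (simp add: sum_power2_gt_zero_iff)
    ultimately show ?thesis using pos[of s] assms(2) by (simp add: add_nonneg_pos)
  qed
  ultimately show ?thesis unfolding phase_increasing_def by blast
qed

text \<open>
  The tangents of the phases add up: \<open>(Y1 x + X1 y) / (X1 x) = Y1 / X1 + y / x\<close>, where the first
  summand is constant or increasing and the second one increases. The Wronskian of the sum is \<open>x\<^sup>2\<close> times the first Wronskian plus \<open>X1\<^sup>2\<close> times the second,
  which also makes sense where the tangents have poles.
\<close>

lemma phase_increasing_join:
  assumes 1: "phase_increasing X1 Y1 \<or> (X1 = (\<lambda>_. 1) \<and> Y1 = (\<lambda>_. 0))"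
    and 2: "phase_increasing x y"
  shows "phase_increasing (\<lambda>s. X1 s * x s) (\<lambda>s. Y1 s * x s + X1 s * y s)"
proof (cases "phase_increasing X1 Y1")
  case False
  then show ?thesis using 1 2 by simp
next
  case True
  then obtain X1' Y1' where d1: "\<And>s. (X1 has_real_derivative X1' s) (at s)" "\<And>s. (Y1 has_real_derivative Y1' s) (at s)"
    and p1: "\<And>s. X1 s \<noteq> 0 \<or> Y1 s \<noteq> 0 \<Longrightarrow> X1 s * Y1' s - Y1 s * X1' s > 0"
    unfolding phase_increasing_def by blast
  obtain x' y' where d2: "\<And>s. (x has_real_derivative x' s) (at s)" "\<And>s. (y has_real_derivative y' s) (at s)"
    and p2: "\<And>s. x s \<noteq> 0 \<or> y s \<noteq> 0 \<Longrightarrow> x s * y' s - y s * x' s > 0"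
    using 2 unfolding phase_increasing_def by blast
  define P where "P s = X1' s * x s + X1 s * x' s" for s
  define Q where "Q s = Y1' s * x s + Y1 s * x' s + (X1' s * y s + X1 s * y' s)" for s
  have "((\<lambda>s. X1 s * x s) has_real_derivative P s) (at s)" for s
    unfolding P_def by (rule derivative_eq_intros d1 d2 refl)+ (simp add: algebra_simps)
  moreover have "((\<lambda>s. Y1 s * x s + X1 s * y s) has_real_derivative Q s) (at s)" for s
    unfolding Q_def by (rule derivative_eq_intros d1 d2 refl)+ (simp add: algebra_simps)
  moreover have "X1 s * x s * Q s - (Y1 s * x s + X1 s * y s) * P s > 0"
    if nz: "X1 s * x s \<noteq> 0 \<or> Y1 s * x s + X1 s * y s \<noteq> 0" for s
  proof -
    have "X1 s * x s * Q s - (Y1 s * x s + X1 s * y s) * P s =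
      (x s)\<^sup>2 * (X1 s * Y1' s - Y1 s * X1' s) + (X1 s)\<^sup>2 * (x s * y' s - y s * x' s)"
      unfolding P_def Q_def by algebra
    moreover have a: "X1 s * Y1' s - Y1 s * X1' s > 0" using p1[of s] nz by (cases "X1 s = 0") auto
    moreover have b: "x s * y' s - y s * x' s > 0" using p2[of s] nz by (cases "x s = 0") auto
    moreover have "x s \<noteq> 0 \<or> X1 s \<noteq> 0" using nz by auto
    ultimately show ?thesis
      by (smt (verit) mult_nonneg_nonneg mult_pos_pos zero_less_power2 zero_le_power2)
  qed
  ultimately show ?thesis unfolding phase_increasing_def by blast
qed

lemma rooted_tree_root_data:
  assumes "rooted_tree G v U A" and "\<And>e. e \<in> A \<Longrightarrow> L e > 0"
  shows "\<exists>X Y. root_data G L v U A X Y \<and>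
    (if A = {} then X = (\<lambda>_. 1) \<and> Y = (\<lambda>_. 0) else phase_increasing X Y)"
  using assms
proof (induction rule: rooted_tree.induct)
  case (single v)
  have "root_data G L v {v} {} (\<lambda>_. 1) (\<lambda>_. 0)"
    unfolding root_data_def wave_def flux_def by auto
  then show ?case by auto
next
  case (graft v U A w W B e)
  from graft.IH(1)[OF graft.prems] obtain X1 Y1 where 1: "root_data G L v U A X1 Y1"
    and p1: "if A = {} then X1 = (\<lambda>_. 1) \<and> Y1 = (\<lambda>_. 0) else phase_increasing X1 Y1" by blast
  from graft.IH(2)[OF graft.prems] obtain X2 Y2 where 2: "root_data G L w W B X2 Y2"
    and p2: "if B = {} then X2 = (\<lambda>_. 1) \<and> Y2 = (\<lambda>_. 0) else phase_increasing X2 Y2" by blast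
  have q1: "phase_increasing X1 Y1 \<or> (X1 = (\<lambda>_. 1) \<and> Y1 = (\<lambda>_. 0))"
    using p1 by (cases "A = {}") simp_all
  have q2: "phase_increasing X2 Y2 \<or> (X2 = (\<lambda>_. 1) \<and> Y2 = (\<lambda>_. 0))"
    using p2 by (cases "B = {}") simp_all
  have "L e > 0" using graft.prems by simp
  note join = phase_increasing_join[OF q1 phase_increasing_rot[OF q2 this]]
  show ?case
    by (intro exI conjI, rule root_data_graft[OF graft.hyps(1-4) 1 2]) (simp add: join)
qed


section \<open>Weak solutions on an interval are classical solutions\<close>

text \<open>
  \<open>f'\<close> is carried along so that the equation \<open>- f'' = z f\<close> becomes a first-order system of
  classical one-sided derivatives on the closed interval.
\<close>

definition edge_solution ::
    "real \<Rightarrow> complex \<Rightarrow> (real \<Rightarrow> complex) \<Rightarrow> (real \<Rightarrow> complex) \<Rightarrow> bool" where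
  "edge_solution l z f f' \<longleftrightarrow> (\<forall>x\<in>{0..l}.
     (f has_vector_derivative f' x) (at x within {0..l}) \<and>
     (f' has_vector_derivative - (z * f x)) (at x within {0..l}))"

lemma continuous_on_of_vector_derivative:
  "(\<And>x. x \<in> S \<Longrightarrow> (f has_vector_derivative f' x) (at x within S)) \<Longrightarrow> continuous_on S f"
  by (meson continuous_on_eq_continuous_within has_vector_derivative_continuous)

lemma edge_solution_continuous:
  assumes "edge_solution l z f f'"
  shows "continuous_on {0..l} f" "continuous_on {0..l} f'"
  using assms unfolding edge_solution_def
  by (auto intro: continuous_on_of_vector_derivative[where f' = f']
      continuous_on_of_vector_derivative[where f' = "\<lambda>x. - (z * f x)"])

lemma set_integral_continuous:
  fixes g :: "real \<Rightarrow> complex"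
  assumes "continuous_on {0..x} g"
  shows "(LINT t:{0..x}|lebesgue. g t) = integral {0..x} g"
  using set_lebesgue_integral_eq_integral(2) absolutely_integrable_continuous_real[OF assms] by blast

lemma has_weak_derivative_classical:
  assumes "\<And>x. x \<in> {0..l} \<Longrightarrow> (f has_vector_derivative g x) (at x within {0..l})"
    and g: "continuous_on {0..l} g"
  shows "has_weak_derivative l f g"
  unfolding has_weak_derivative_def L2_on_def
proof (intro conjI ballI)
  show "g \<in> borel_measurable (lebesgue_on {0..l})"
    using g by (rule continuous_imp_measurable_on_sets_lebesgue) simp
  show "integrable (lebesgue_on {0..l}) (\<lambda>x. (cmod (g x))\<^sup>2)"
    by (intro continuous_imp_integrable_real continuous_intros g)
  fix x assume x: "x \<in> {0..l}"
  have "(g has_integral (f x - f 0)) {0..x}"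
  proof (rule fundamental_theorem_of_calculus)
    show "(f has_vector_derivative g t) (at t within {0..x})" if "t \<in> {0..x}" for t
      using assms(1)[of t] that x by (auto intro: has_vector_derivative_within_subset)
  qed (use x in simp)
  moreover have "continuous_on {0..x} g" using g x by (auto intro: continuous_on_subset)
  ultimately show "f x = f 0 + (LINT t:{0..x}|lebesgue. g t)"
    by (simp add: set_integral_continuous integral_unique)
qed

lemma edge_deriv_eqI:
  assumes "(f has_vector_derivative f') (at x within {0..l})" "x \<in> {0..l}" "0 < l"
  shows "edge_deriv l f x = f'"
  unfolding edge_deriv_def using assms by (intro vector_derivative_within_closed_interval) auto

lemma edge_solution_imp_weak:
  assumes sol: "edge_solution l z f f'" and l: "0 < l"
  shows "H1_on l f" "H2_on l f" "has_weak_derivative l (edge_deriv l f) (\<lambda>x. - (z * f x))"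
    "x \<in> {0..l} \<Longrightarrow> edge_deriv l f x = f' x"
proof -
  have d: "(f has_vector_derivative f' x) (at x within {0..l})"
      "(f' has_vector_derivative - (z * f x)) (at x within {0..l})" if "x \<in> {0..l}" for x
    using sol that by (auto simp: edge_solution_def)
  have eq: "edge_deriv l f x = f' x" if "x \<in> {0..l}" for x
    using edge_deriv_eqI[OF d(1)[OF that] that l] .
  then show "x \<in> {0..l} \<Longrightarrow> edge_deriv l f x = f' x" by blast
  note cont = edge_solution_continuous[OF sol]
  show "H1_on l f"
    unfolding H1_on_def using has_weak_derivative_classical[OF d(1) cont(2)] by blast
  show w: "has_weak_derivative l (edge_deriv l f) (\<lambda>x. - (z * f x))"
  proof (rule has_weak_derivative_classical)
    fix x assume x: "x \<in> {0..l}"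
    show "(edge_deriv l f has_vector_derivative - (z * f x)) (at x within {0..l})"
      using d(2)[OF x] by (rule has_vector_derivative_transform[rotated 2]) (use x eq in auto)
  qed (intro continuous_intros cont)
  show "H2_on l f"
    unfolding H2_on_def H1_on_def using w d(1) by (blast intro: differentiableI_vector)
qed

text \<open>
  Regularity: the weak second derivative agrees almost everywhere with the continuous function
  \<open>- z f\<close>, hence the first derivative is an antiderivative of that continuous function.
\<close>

lemma weak_imp_edge_solution:
  assumes H2: "H2_on l f" and l: "0 < l" and g: "has_weak_derivative l (edge_deriv l f) g"
    and ae: "AE x in lebesgue_on {0..l}. z * f x = - g x"
  shows "edge_solution l z f (edge_deriv l f)"
proof -
  have d1: "(f has_vector_derivative edge_deriv l f x) (at x within {0..l})" if "x \<in> {0..l}" for x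
    using H2 that unfolding H2_on_def edge_deriv_def by (simp flip: vector_derivative_works)
  then have f: "continuous_on {0..l} f" by (rule continuous_on_of_vector_derivative)
  let ?h = "\<lambda>x. - (z * f x)"
  have h: "continuous_on {0..l} ?h" by (intro continuous_intros f)
  have eq: "edge_deriv l f x = edge_deriv l f 0 + integral {0..x} ?h" if x: "x \<in> {0..l}" for x
  proof -
    have sub: "{0..x} \<subseteq> {0..l}" using x by auto
    have hx: "continuous_on {0..x} ?h" using continuous_on_subset[OF h sub] .
    have r: "integral\<^sup>L (lebesgue_on {0..x}) k = (LINT t:{0..x}|lebesgue. k t)" for k :: "real \<Rightarrow> complex"
      unfolding set_lebesgue_integral_def by (rule integral_restrict_space) simp
    have gm: "g \<in> borel_measurable (lebesgue_on {0..x})"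
      using g sub unfolding has_weak_derivative_def L2_on_def by (blast intro: measurable_restrict_mono)
    have hm: "?h \<in> borel_measurable (lebesgue_on {0..x})"
      using hx by (rule continuous_imp_measurable_on_sets_lebesgue) simp
    have "AE t in lebesgue_on {0..x}. g t = ?h t"
      using ae sub by (auto simp: AE_restrict_space_iff elim!: eventually_mono)
    then have "integral\<^sup>L (lebesgue_on {0..x}) g = integral\<^sup>L (lebesgue_on {0..x}) ?h"
      by (rule integral_cong_AE[OF gm hm])
    then have "(LINT t:{0..x}|lebesgue. g t) = (LINT t:{0..x}|lebesgue. ?h t)"
      unfolding r .
    moreover have "edge_deriv l f x = edge_deriv l f 0 + (LINT t:{0..x}|lebesgue. g t)"
      using g x unfolding has_weak_derivative_def by blast
    ultimately show ?thesis unfolding set_integral_continuous[OF hx] by (simp only:)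
  qed
  have d2: "(edge_deriv l f has_vector_derivative ?h x) (at x within {0..l})" if x: "x \<in> {0..l}" for x
  proof -
    have "((\<lambda>x. edge_deriv l f 0 + integral {0..x} ?h) has_vector_derivative (0 + ?h x)) (at x within {0..l})"
      by (intro has_vector_derivative_add has_vector_derivative_const
          integral_has_vector_derivative[OF h x])
    then have "((\<lambda>x. edge_deriv l f 0 + integral {0..x} ?h) has_vector_derivative ?h x) (at x within {0..l})"
      by simp
    from has_vector_derivative_transform[OF x eq this] show ?thesis .
  qed
  show ?thesis unfolding edge_solution_def using d1 d2 by blast
qed


section \<open>The explicit solutions\<close>

text \<open>
  The solution of \<open>- f'' = s\<^sup>2 f\<close> with \<open>f 0 = 0\<close> and \<open>f' 0 = 1\<close>. Including \<open>s = 0\<close> makes it continuous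
  in \<open>s\<close>, so that sequences of frequencies may tend to \<open>0\<close>.
\<close>

definition sin_quot :: "real \<Rightarrow> real \<Rightarrow> real" where
  "sin_quot s x = (if s = 0 then x else sin (s * x) / s)"

lemma sin_quot_0 [simp]: "sin_quot s 0 = 0"
  by (simp add: sin_quot_def)

lemma mult_sin_quot: "s * sin_quot s x = sin (s * x)"
  by (simp add: sin_quot_def)

lemma DERIV_sin_quot [derivative_intros]:
  assumes "(g has_real_derivative g') (at x within S)"
  shows "((\<lambda>x. sin_quot s (g x)) has_real_derivative cos (s * g x) * g') (at x within S)"
  unfolding sin_quot_def using assms
  by (cases "s = 0") (auto intro!: derivative_eq_intros)

lemma sin_quot_bound: "\<bar>sin_quot s x\<bar> \<le> \<bar>x\<bar>"
proof (cases "s = 0")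
  case False
  have "\<bar>s * sin_quot s x\<bar> \<le> \<bar>s * x\<bar>" unfolding mult_sin_quot by (rule abs_sin_x_le_abs_x)
  then show ?thesis using False by (simp add: abs_mult)
qed (simp add: sin_quot_def)

lemma tendsto_sin_quot:
  assumes "(s \<longlongrightarrow> s') F"
  shows "((\<lambda>n. sin_quot (s n) x) \<longlongrightarrow> sin_quot s' x) F"
proof -
  have "isCont (\<lambda>s. sin_quot s x) s'"
  proof (cases "s' = 0")
    case False
    have "isCont (\<lambda>s. sin (s * x) / s) s'" using False by (intro continuous_intros) auto
    moreover have "\<forall>\<^sub>F s in nhds s'. sin (s * x) / s = sin_quot s x"
      using t1_space_nhds[OF False] by eventually_elim (simp add: sin_quot_def)
    ultimately show ?thesis by (metis isCont_cong)
  next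
    case True
    have "((\<lambda>s. sin (s * x)) has_real_derivative x) (at 0)"
      by (auto intro!: derivative_eq_intros)
    then have "((\<lambda>s. sin (s * x) / s) \<longlongrightarrow> x) (at 0)"
      by (simp add: has_field_derivative_iff)
    then have "((\<lambda>s. sin_quot s x) \<longlongrightarrow> x) (at 0)"
      by (rule Lim_transform_eventually) (auto simp: sin_quot_def eventually_at_filter)
    then show ?thesis using True by (simp add: isCont_def sin_quot_def)
  qed
  then show ?thesis using assms isCont_tendsto_compose by blast
qed

text \<open>
  The general solution of \<open>- f'' = s\<^sup>2 f\<close>. Its initial value \<open>a\<close> and slope \<open>b\<close> serve as parameters
  because they determine it for \<open>s = 0\<close> as well; \<open>osc'\<close> is the derivative.
\<close>

definition osc :: "real \<Rightarrow> complex \<Rightarrow> complex \<Rightarrow> real \<Rightarrow> complex" where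
  "osc s a b x = a * cos (s * x) + b * sin_quot s x"

definition osc' :: "real \<Rightarrow> complex \<Rightarrow> complex \<Rightarrow> real \<Rightarrow> complex" where
  "osc' s a b x = b * cos (s * x) - a * (s * sin (s * x))"

lemma osc_0 [simp]: "osc s a b 0 = a" "osc' s a b 0 = b"
  by (simp_all add: osc_def osc'_def)

lemma has_vector_derivative_of_real':
  "(g has_real_derivative g') F \<Longrightarrow> ((\<lambda>x. complex_of_real (g x)) has_vector_derivative complex_of_real g') F"
  by (simp add: has_vector_derivative_complex_iff)

lemma osc_derivs:
  "(osc s a b has_vector_derivative osc' s a b x) (at x within S)"
  "(osc' s a b has_vector_derivative - ((of_real s)\<^sup>2 * osc s a b x)) (at x within S)"
proof -
  have c: "((\<lambda>x. complex_of_real (cos (s * x))) has_vector_derivative of_real (- (s * sin (s * x)))) (at x within S)"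
    by (rule has_vector_derivative_of_real') (auto intro!: derivative_eq_intros)
  have q: "((\<lambda>x. complex_of_real (sin_quot s x)) has_vector_derivative of_real (cos (s * x))) (at x within S)"
    by (rule has_vector_derivative_of_real') (auto intro!: derivative_eq_intros)
  have n: "((\<lambda>x. complex_of_real (s * sin (s * x))) has_vector_derivative of_real (s * (s * cos (s * x)))) (at x within S)"
    by (rule has_vector_derivative_of_real') (auto intro!: derivative_eq_intros)
  have "((\<lambda>x. a * of_real (cos (s * x)) + b * of_real (sin_quot s x)) has_vector_derivative
      (a * of_real (- (s * sin (s * x))) + b * of_real (cos (s * x)))) (at x within S)"
    by (intro has_vector_derivative_add has_vector_derivative_mult_right c q)
  then show "(osc s a b has_vector_derivative osc' s a b x) (at x within S)"
    by (simp add: osc_def[abs_def] osc'_def algebra_simps)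
  have "((\<lambda>x. b * of_real (cos (s * x)) - a * of_real (s * sin (s * x))) has_vector_derivative
      (b * of_real (- (s * sin (s * x))) - a * of_real (s * (s * cos (s * x))))) (at x within S)"
    by (intro has_vector_derivative_diff has_vector_derivative_mult_right c n)
  moreover have "b * of_real (- (s * sin (s * x))) - a * of_real (s * (s * cos (s * x))) =
      - ((of_real s)\<^sup>2 * osc s a b x)"
    unfolding osc_def mult_sin_quot[symmetric] by (simp add: power2_eq_square algebra_simps)
  ultimately show "(osc' s a b has_vector_derivative - ((of_real s)\<^sup>2 * osc s a b x)) (at x within S)"
    by (simp add: osc'_def[abs_def])
qed

lemma edge_solution_osc: "edge_solution l ((of_real s)\<^sup>2) (osc s a b) (osc' s a b)"
  unfolding edge_solution_def using osc_derivs by blast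

text \<open>
  With \<open>c = cos (s x)\<close>, \<open>q = sin_quot s x\<close> and \<open>n = - c'\<close>, the expressions \<open>f c - f' q\<close> and
  \<open>f' c + f n\<close> are constant along solutions, so they equal \<open>f 0\<close> and \<open>f' 0\<close>. Since
  \<open>c\<^sup>2 + n q = 1\<close>, this linear system can be solved for \<open>f\<close> and \<open>f'\<close>.
\<close>

lemma edge_solution_unique:
  assumes sol: "edge_solution l ((of_real s)\<^sup>2) f f'" and x: "x \<in> {0..l}"
  shows "f x = osc s (f 0) (f' 0) x" "f' x = osc' s (f 0) (f' 0) x"
proof -
  define c where "c x = complex_of_real (cos (s * x))" for x
  define q where "q x = complex_of_real (sin_quot s x)" for x
  define n where "n x = complex_of_real (s * sin (s * x))" for x
  have n: "n x = (of_real s)\<^sup>2 * q x" for x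
    unfolding n_def q_def mult_sin_quot[symmetric] by (simp add: power2_eq_square)
  have cn: "c x * c x + n x * q x = 1" for x
  proof -
    have "s * sin (s * x) * sin_quot s x = sin (s * x) * (s * sin_quot s x)"
      by (simp only: mult_ac)
    then have "cos (s * x) * cos (s * x) + s * sin (s * x) * sin_quot s x = 1"
      using sin_cos_squared_add3[of "s * x"] unfolding mult_sin_quot by linarith
    then show ?thesis unfolding c_def n_def q_def of_real_mult[symmetric] of_real_add[symmetric] by simp
  qed
  have dc: "(c has_vector_derivative - n x) (at x within S)" for x S
    unfolding c_def[abs_def] n_def of_real_minus[symmetric]
    by (rule has_vector_derivative_of_real') (auto intro!: derivative_eq_intros)
  have dq: "(q has_vector_derivative c x) (at x within S)" for x S
    unfolding c_def q_def[abs_def]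
    by (rule has_vector_derivative_of_real') (auto intro!: derivative_eq_intros)
  have dn: "(n has_vector_derivative (of_real s)\<^sup>2 * c x) (at x within S)" for x S
    unfolding n[abs_def] by (intro has_vector_derivative_mult_right dq)
  note df = sol[unfolded edge_solution_def, rule_format]
  have "((\<lambda>x. f x * c x - f' x * q x) has_vector_derivative 0) (at x within {0..l})"
    if x: "x \<in> {0..l}" for x
  proof -
    have "((\<lambda>x. f x * c x - f' x * q x) has_vector_derivative
       (f x * - n x + f' x * c x - (f' x * c x + - ((of_real s)\<^sup>2 * f x) * q x))) (at x within {0..l})"
      using df[OF x] by (intro has_vector_derivative_diff has_vector_derivative_mult dc dq) auto
    then show ?thesis by (simp add: n algebra_simps)
  qed
  then obtain k1 where "\<And>x. x \<in> {0..l} \<Longrightarrow> f x * c x - f' x * q x = k1"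
    using has_vector_derivative_zero_constant[of "{0..l}" "\<lambda>x. f x * c x - f' x * q x"] by auto
  from this[OF x] this[of 0] x have 1: "f x * c x - f' x * q x = f 0"
    by (simp add: c_def q_def)
  have "((\<lambda>x. f' x * c x + f x * n x) has_vector_derivative 0) (at x within {0..l})"
    if x: "x \<in> {0..l}" for x
  proof -
    have "((\<lambda>x. f' x * c x + f x * n x) has_vector_derivative
       (f' x * - n x + - ((of_real s)\<^sup>2 * f x) * c x + (f x * ((of_real s)\<^sup>2 * c x) + f' x * n x)))
       (at x within {0..l})"
      using df[OF x] by (intro has_vector_derivative_add has_vector_derivative_mult dc dn) auto
    then show ?thesis by (simp add: algebra_simps)
  qed
  then obtain k2 where "\<And>x. x \<in> {0..l} \<Longrightarrow> f' x * c x + f x * n x = k2"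
    using has_vector_derivative_zero_constant[of "{0..l}" "\<lambda>x. f' x * c x + f x * n x"] by auto
  from this[OF x] this[of 0] x have 2: "f' x * c x + f x * n x = f' 0"
    by (simp add: c_def n_def)
  have "f x = f x * (c x * c x + n x * q x)" by (simp add: cn)
  also have "\<dots> = (f x * c x - f' x * q x) * c x + (f' x * c x + f x * n x) * q x"
    by (simp add: algebra_simps)
  finally show "f x = osc s (f 0) (f' 0) x"
    unfolding 1 2 by (simp add: osc_def c_def q_def)
  have "f' x = f' x * (c x * c x + n x * q x)" by (simp add: cn)
  also have "\<dots> = (f' x * c x + f x * n x) * c x - (f x * c x - f' x * q x) * n x"
    by (simp add: algebra_simps)
  finally show "f' x = osc' s (f 0) (f' 0) x"
    unfolding 1 2 by (simp add: osc'_def c_def n_def)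
qed


section \<open>Eigenspaces and standing waves\<close>

text \<open>
  The eigenfunctions for \<open>s\<^sup>2\<close>, described by their values \<open>a e\<close> and slopes \<open>b e\<close> at the originating
  vertices of the edges. This turns the eigenvalue equation into finitely many linear equations.
\<close>

definition standing_wave ::
    "('v, 'e) pre_digraph \<Rightarrow> ('e \<Rightarrow> real) \<Rightarrow> real \<Rightarrow> ('e \<Rightarrow> complex) \<Rightarrow> ('e \<Rightarrow> complex) \<Rightarrow> bool" where
  "standing_wave G L s a b \<longleftrightarrow>
     (\<exists>\<phi>. \<forall>e\<in>arcs G. \<phi> (tail G e) = a e \<and> \<phi> (head G e) = osc s (a e) (b e) (L e)) \<and>
     (\<forall>v\<in>verts G. (\<Sum>e | e \<in> arcs G \<and> head G e = v. osc' s (a e) (b e) (L e)) -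
                   (\<Sum>e | e \<in> arcs G \<and> tail G e = v. b e) = 0)"

definition graph_osc ::
    "('v, 'e) pre_digraph \<Rightarrow> ('e \<Rightarrow> real) \<Rightarrow> real \<Rightarrow> ('e \<Rightarrow> complex) \<Rightarrow> ('e \<Rightarrow> complex) \<Rightarrow> 'e graph_fun" where
  "graph_osc G L s a b e x = (if e \<in> arcs G \<and> x \<in> {0..L e} then osc s (a e) (b e) x else 0)"

lemma edge_solution_cong:
  assumes "edge_solution l z g g'" "\<And>x. x \<in> {0..l} \<Longrightarrow> f x = g x"
  shows "edge_solution l z f g'"
  using assms unfolding edge_solution_def
  by (auto intro: has_vector_derivative_transform[of _ "{0..l}" f g])

lemma osc_scale: "osc s (c * a) (c * b) x = c * osc s a b x" "osc' s (c * a) (c * b) x = c * osc' s a b x"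
  by (simp_all add: osc_def osc'_def algebra_simps)

lemma osc_eq_0_imp:
  assumes "\<And>x. x \<in> {0..l} \<Longrightarrow> osc s a b x = 0" "0 < l"
  shows "a = 0" "b = 0"
proof -
  show "a = 0" using assms(1)[of 0] assms(2) by simp
  have z: "0 \<in> {0..l}" using assms(2) by simp
  have "(osc s a b has_vector_derivative 0) (at 0 within {0..l})"
    using has_vector_derivative_transform[OF z assms(1) has_vector_derivative_const] by simp
  then show "b = 0"
    using edge_deriv_eqI[OF _ z assms(2)] osc_derivs(1)[of s a b 0 "{0..l}"] by (metis osc_0(2))
qed

context metric_graph
begin

lemma eigenspace_edge_solution:
  assumes "f \<in> eigenspace G L z" "e \<in> arcs G"
  shows "edge_solution (L e) z (f e) (edge_deriv (L e) (f e))"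
proof -
  obtain g where g: "has_weak_derivative (L e) (edge_deriv (L e) (f e)) g"
    "AE x in lebesgue_on {0..L e}. z * f e x = - g x"
    using assms unfolding eigenspace_def neg_laplacian_def graph_fun_scale_def by blast
  have "H2_on (L e) (f e)"
    using assms unfolding eigenspace_def neg_laplacian_def laplacian_domain_def by blast
  then show ?thesis using weak_imp_edge_solution[OF _ length_pos[OF assms(2)] g] by blast
qed

lemma eigenspace_vertexD:
  assumes "f \<in> eigenspace G L z"
  shows "supported_on_graph G L f" "continuous_at_vertices G L f"
    "v \<in> verts G \<Longrightarrow> normal_deriv G L f v = 0"
  using assms unfolding eigenspace_def neg_laplacian_def laplacian_domain_def H1_graph_def by auto

lemma eigenspace_imp_standing_wave:
  assumes f: "f \<in> eigenspace G L ((of_real s)\<^sup>2)"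
  obtains a b where "standing_wave G L s a b" "f = graph_osc G L s a b"
proof -
  define a where "a e = f e 0" for e
  define b where "b e = edge_deriv (L e) (f e) 0" for e
  have eq: "f e x = osc s (a e) (b e) x" "edge_deriv (L e) (f e) x = osc' s (a e) (b e) x"
    if "e \<in> arcs G" "x \<in> {0..L e}" for e x
    using edge_solution_unique[OF eigenspace_edge_solution[OF f that(1)] that(2)]
    unfolding a_def b_def by auto
  have "f = graph_osc G L s a b"
    using eigenspace_vertexD(1)[OF f] eq(1)
    by (auto simp: fun_eq_iff graph_osc_def supported_on_graph_def)
  moreover have "standing_wave G L s a b"
    unfolding standing_wave_def
  proof (intro conjI ballI)
    obtain \<phi> where \<phi>: "\<forall>e\<in>arcs G. f e 0 = \<phi> (tail G e) \<and> f e (L e) = \<phi> (head G e)"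
      using eigenspace_vertexD(2)[OF f] unfolding continuous_at_vertices_def by blast
    have "f e (L e) = osc s (a e) (b e) (L e)" if "e \<in> arcs G" for e
      using eq(1)[OF that, of "L e"] length_pos[OF that] by simp
    then have "\<forall>e\<in>arcs G. \<phi> (tail G e) = a e \<and> \<phi> (head G e) = osc s (a e) (b e) (L e)"
      using \<phi> a_def by metis
    then show "\<exists>\<phi>. \<forall>e\<in>arcs G. \<phi> (tail G e) = a e \<and> \<phi> (head G e) = osc s (a e) (b e) (L e)"
      by blast
    fix v assume "v \<in> verts G"
    then have "normal_deriv G L f v = 0" using eigenspace_vertexD(3)[OF f] by blast
    moreover have "(\<Sum>e | e \<in> arcs G \<and> head G e = v. edge_deriv (L e) (f e) (L e)) =
        (\<Sum>e | e \<in> arcs G \<and> head G e = v. osc' s (a e) (b e) (L e))"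
      by (intro sum.cong refl eq(2)) (use length_pos in \<open>auto simp: less_imp_le\<close>)
    ultimately show "(\<Sum>e | e \<in> arcs G \<and> head G e = v. osc' s (a e) (b e) (L e)) -
        (\<Sum>e | e \<in> arcs G \<and> tail G e = v. b e) = 0"
      unfolding normal_deriv_def b_def by simp
  qed
  ultimately show thesis using that by blast
qed

lemma standing_wave_imp_eigenspace:
  assumes w: "standing_wave G L s a b"
  shows "graph_osc G L s a b \<in> eigenspace G L ((of_real s)\<^sup>2)"
proof -
  let ?f = "graph_osc G L s a b"
  have sol: "edge_solution (L e) ((of_real s)\<^sup>2) (?f e) (osc' s (a e) (b e))" if "e \<in> arcs G" for e
    by (rule edge_solution_cong[OF edge_solution_osc[of _ s "a e" "b e"]])
      (use that in \<open>simp add: graph_osc_def\<close>)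
  note weak = edge_solution_imp_weak[OF sol length_pos]
  have "supported_on_graph G L ?f" unfolding supported_on_graph_def graph_osc_def by auto
  moreover have "continuous_at_vertices G L ?f"
  proof -
    obtain \<phi> where \<phi>: "\<forall>e\<in>arcs G. \<phi> (tail G e) = a e \<and> \<phi> (head G e) = osc s (a e) (b e) (L e)"
      using w unfolding standing_wave_def by blast
    have "?f e 0 = \<phi> (tail G e) \<and> ?f e (L e) = \<phi> (head G e)" if "e \<in> arcs G" for e
      using \<phi> that length_pos[OF that] by (simp add: graph_osc_def)
    then show ?thesis unfolding continuous_at_vertices_def by blast
  qed
  moreover have "normal_deriv G L ?f v = 0" if "v \<in> verts G" for v
  proof -
    have "(\<Sum>e | e \<in> arcs G \<and> head G e = v. edge_deriv (L e) (?f e) (L e)) =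
        (\<Sum>e | e \<in> arcs G \<and> head G e = v. osc' s (a e) (b e) (L e))"
      by (intro sum.cong refl weak(4)) (use length_pos in \<open>auto simp: less_imp_le\<close>)
    moreover have "(\<Sum>e | e \<in> arcs G \<and> tail G e = v. edge_deriv (L e) (?f e) 0) =
        (\<Sum>e | e \<in> arcs G \<and> tail G e = v. osc' s (a e) (b e) 0)"
      by (intro sum.cong refl weak(4)) (use length_pos in \<open>auto simp: less_imp_le\<close>)
    ultimately show ?thesis using w that by (simp add: normal_deriv_def standing_wave_def)
  qed
  ultimately have "?f \<in> laplacian_domain G L"
    using weak(1,2) unfolding laplacian_domain_def H1_graph_def by blast
  moreover have "\<exists>g. has_weak_derivative (L e) (edge_deriv (L e) (?f e)) g \<and>
      (AE x in lebesgue_on {0..L e}. (of_real s)\<^sup>2 * ?f e x = - g x)" if "e \<in> arcs G" for e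
    using weak(3)[OF that that] by (intro exI[of _ "\<lambda>x. - ((of_real s)\<^sup>2 * ?f e x)"]) simp
  ultimately show ?thesis
    unfolding eigenspace_def neg_laplacian_def graph_fun_scale_def by blast
qed

text \<open>
  Collecting the boundary terms of all edges at the vertices: for a continuous \<open>\<phi>\<close> the boundary
  terms of an integration by parts cancel by the Kirchhoff conditions.
\<close>

lemma boundary_sum:
  fixes D1 D0 :: "'e \<Rightarrow> complex" and \<phi> :: "'v \<Rightarrow> complex"
  assumes "\<And>v. v \<in> verts G \<Longrightarrow>
    (\<Sum>e | e \<in> arcs G \<and> head G e = v. D1 e) - (\<Sum>e | e \<in> arcs G \<and> tail G e = v. D0 e) = 0"
  shows "(\<Sum>e\<in>arcs G. \<phi> (head G e) * D1 e - \<phi> (tail G e) * D0 e) = 0"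
proof -
  have group: "(\<Sum>e\<in>arcs G. \<phi> (p e) * D e) = (\<Sum>v\<in>verts G. \<phi> v * (\<Sum>e | e \<in> arcs G \<and> p e = v. D e))"
    if "p ` arcs G \<subseteq> verts G" for p :: "'e \<Rightarrow> 'v" and D :: "'e \<Rightarrow> complex"
  proof -
    have "(\<Sum>v\<in>verts G. \<Sum>e | e \<in> arcs G \<and> p e = v. \<phi> (p e) * D e) = (\<Sum>e\<in>arcs G. \<phi> (p e) * D e)"
      by (rule sum.group) (use that in auto)
    moreover have "(\<Sum>e | e \<in> arcs G \<and> p e = v. \<phi> (p e) * D e) = \<phi> v * (\<Sum>e | e \<in> arcs G \<and> p e = v. D e)" for v
      by (simp add: sum_distrib_left)
    ultimately show ?thesis by simp
  qed
  have "(\<Sum>e\<in>arcs G. \<phi> (head G e) * D1 e - \<phi> (tail G e) * D0 e) =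
     (\<Sum>v\<in>verts G. \<phi> v * ((\<Sum>e | e \<in> arcs G \<and> head G e = v. D1 e) - (\<Sum>e | e \<in> arcs G \<and> tail G e = v. D0 e)))"
    unfolding sum_subtractf right_diff_distrib by (subst (1 2) group) auto
  then show ?thesis using assms by simp
qed

text \<open>
  Summing \<open>(Re (cnj f f'))' = \<bar>f'\<bar>\<^sup>2 - \<mu> \<bar>f\<bar>\<^sup>2\<close> over the edges leaves no boundary term, so for negative
  \<open>\<mu>\<close> the nonnegative right-hand side vanishes identically.
\<close>

lemma is_eigenvalue_nonneg:
  assumes "is_eigenvalue G L \<mu>"
  shows "0 \<le> \<mu>"
proof (rule ccontr)
  assume "\<not> 0 \<le> \<mu>"
  then have neg: "\<mu> < 0" by simp
  obtain f where f: "f \<in> eigenspace G L (of_real \<mu>)" "f \<noteq> 0"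
    using assms unfolding is_eigenvalue_def by blast
  define f' where "f' e = edge_deriv (L e) (f e)" for e
  obtain \<phi> where \<phi>: "\<And>e. e \<in> arcs G \<Longrightarrow> f e 0 = \<phi> (tail G e) \<and> f e (L e) = \<phi> (head G e)"
    using eigenspace_vertexD(2)[OF f(1)] unfolding continuous_at_vertices_def by blast
  define p where "p e x = (cmod (f' e x))\<^sup>2 - \<mu> * (cmod (f e x))\<^sup>2" for e x
  define B where "B e = Re (cnj (f e (L e)) * f' e (L e)) - Re (cnj (f e 0) * f' e 0)" for e
  have sol: "edge_solution (L e) (of_real \<mu>) (f e) (f' e)" if "e \<in> arcs G" for e
    using eigenspace_edge_solution[OF f(1) that] unfolding f'_def .
  have p: "(p e has_integral B e) {0..L e}" if e: "e \<in> arcs G" for e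
    unfolding B_def
  proof (rule fundamental_theorem_of_calculus)
    fix x assume x: "x \<in> {0..L e}"
    have "((\<lambda>x. cnj (f e x) * f' e x) has_vector_derivative
        (cnj (f e x) * - (of_real \<mu> * f e x) + cnj (f' e x) * f' e x)) (at x within {0..L e})"
      using sol[OF e] x unfolding edge_solution_def
      by (intro has_vector_derivative_mult has_vector_derivative_cnj) auto
    then have "((\<lambda>x. Re (cnj (f e x) * f' e x)) has_real_derivative
        Re (cnj (f e x) * - (of_real \<mu> * f e x) + cnj (f' e x) * f' e x)) (at x within {0..L e})"
      unfolding has_vector_derivative_complex_iff by blast
    moreover have "Re (cnj (f e x) * - (of_real \<mu> * f e x) + cnj (f' e x) * f' e x) = p e x"
      unfolding p_def cmod_power2 by (simp add: power2_eq_square algebra_simps)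
    ultimately show "((\<lambda>x. Re (cnj (f e x) * f' e x)) has_vector_derivative p e x) (at x within {0..L e})"
      by (simp add: has_real_derivative_iff_has_vector_derivative)
  qed (use length_pos[OF e] in simp)
  have nonpos: "\<mu> * (cmod (f e x))\<^sup>2 \<le> 0" for e x using neg by (intro mult_nonpos_nonneg) auto
  then have pos: "0 \<le> p e x" for e x unfolding p_def using nonpos[of e x] zero_le_power2[of "cmod (f' e x)"] by linarith
  have "(\<Sum>e\<in>arcs G. cnj (\<phi> (head G e)) * f' e (L e) - cnj (\<phi> (tail G e)) * f' e 0) = 0"
    by (rule boundary_sum[where \<phi> = "\<lambda>v. cnj (\<phi> v)"])
      (use eigenspace_vertexD(3)[OF f(1)] in \<open>simp add: normal_deriv_def f'_def\<close>)
  then have "Re (\<Sum>e\<in>arcs G. cnj (\<phi> (head G e)) * f' e (L e) - cnj (\<phi> (tail G e)) * f' e 0) = 0"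
    by simp
  moreover have "Re (\<Sum>e\<in>arcs G. cnj (\<phi> (head G e)) * f' e (L e) - cnj (\<phi> (tail G e)) * f' e 0) =
      (\<Sum>e\<in>arcs G. B e)"
    unfolding Re_sum by (intro sum.cong) (use \<phi> in \<open>auto simp: B_def\<close>)
  ultimately have "(\<Sum>e\<in>arcs G. B e) = 0" by simp
  moreover have "0 \<le> B e" if "e \<in> arcs G" for e
    using has_integral_nonneg[OF p[OF that]] pos by blast
  ultimately have B0: "B e = 0" if "e \<in> arcs G" for e
    using that sum_nonneg_eq_0_iff[of "arcs G" B] by auto
  have "f e x = 0" if e: "e \<in> arcs G" and x: "x \<in> {0..L e}" for e x
  proof -
    have "continuous_on (cbox 0 (L e)) (p e)"
      unfolding p_def[abs_def] box_real using edge_solution_continuous[OF sol[OF e]]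
      by (intro continuous_intros) auto
    then have "p e x = 0"
      by (rule has_integral_0_cbox_imp_0) (use pos p[OF e] B0[OF e] length_pos[OF e] x in auto)
    then have "\<mu> * (cmod (f e x))\<^sup>2 = 0"
      unfolding p_def using nonpos[of e x] zero_le_power2[of "cmod (f' e x)"] by linarith
    then show ?thesis using neg by simp
  qed
  then have "f = 0"
    using eigenspace_vertexD(1)[OF f(1)] by (auto simp: fun_eq_iff supported_on_graph_def)
  then show False using f(2) by contradiction
qed

lemma is_eigenvalue_square_iff:
  "is_eigenvalue G L (s\<^sup>2) \<longleftrightarrow>
    (\<exists>a b. standing_wave G L s a b \<and> (\<exists>e\<in>arcs G. a e \<noteq> 0 \<or> b e \<noteq> 0))"
proof
  assume "is_eigenvalue G L (s\<^sup>2)"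
  then obtain f where f: "f \<in> eigenspace G L ((of_real s)\<^sup>2)" "f \<noteq> 0"
    unfolding is_eigenvalue_def by auto
  then obtain a b where ab: "standing_wave G L s a b" "f = graph_osc G L s a b"
    using eigenspace_imp_standing_wave by blast
  have "\<exists>e\<in>arcs G. a e \<noteq> 0 \<or> b e \<noteq> 0"
  proof (rule ccontr)
    assume "\<not> ?thesis"
    then have "graph_osc G L s a b = 0" by (auto simp: fun_eq_iff graph_osc_def osc_def)
    then show False using f(2) ab(2) by simp
  qed
  then show "\<exists>a b. standing_wave G L s a b \<and> (\<exists>e\<in>arcs G. a e \<noteq> 0 \<or> b e \<noteq> 0)" using ab by blast
next
  assume "\<exists>a b. standing_wave G L s a b \<and> (\<exists>e\<in>arcs G. a e \<noteq> 0 \<or> b e \<noteq> 0)"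
  then obtain a b e where ab: "standing_wave G L s a b" "e \<in> arcs G" "a e \<noteq> 0 \<or> b e \<noteq> 0" by blast
  have "graph_osc G L s a b \<noteq> 0"
  proof
    assume "graph_osc G L s a b = 0"
    then have "\<And>x. graph_osc G L s a b e x = 0" by simp
    then have "\<And>x. x \<in> {0..L e} \<Longrightarrow> osc s (a e) (b e) x = 0"
      using ab(2) unfolding graph_osc_def by meson
    then show False using osc_eq_0_imp length_pos[OF ab(2)] ab(3) by blast
  qed
  then show "is_eigenvalue G L (s\<^sup>2)"
    using standing_wave_imp_eigenspace[OF ab(1)] unfolding is_eigenvalue_def by auto
qed

lemma sum_graph_fun_apply: "(\<Sum>i\<in>I. F i) e x = (\<Sum>i\<in>I. (F i :: 'e graph_fun) e x)"
  by (induction I rule: infinite_finite_induct) auto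

text \<open>
  By convention the dimension of an infinite-dimensional space is \<open>0\<close>, so a nonzero eigenfunction alone
  does not suffice. The eigenspace lies in the span of the finitely many functions that have unit
  initial data on one edge and vanish on the others.
\<close>

lemma multiplicity_pos:
  assumes "is_eigenvalue G L \<mu>"
  shows "1 \<le> multiplicity G L \<mu>"
proof -
  define s where "s = sqrt \<mu>"
  have s: "s\<^sup>2 = \<mu>" using is_eigenvalue_nonneg[OF assms] by (simp add: s_def)
  have z: "complex_of_real \<mu> = (of_real s)\<^sup>2" unfolding s[symmetric] by simp
  let ?E = "eigenspace G L (complex_of_real \<mu>)"
  define c where "c d = graph_osc G L s (\<lambda>e. if e = d then 1 else 0) (\<lambda>_. 0)" for d
  define q where "q d = graph_osc G L s (\<lambda>_. 0) (\<lambda>e. if e = d then 1 else 0)" for d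
  let ?T = "c ` arcs G \<union> q ` arcs G"
  have "?E \<subseteq> graph_fun.span ?T"
  proof
    fix f assume "f \<in> ?E"
    then obtain a b where f: "f = graph_osc G L s a b"
      unfolding z using eigenspace_imp_standing_wave by blast
    have "f = (\<Sum>d\<in>arcs G. graph_fun_scale (a d) (c d) + graph_fun_scale (b d) (q d))"
    proof (intro ext)
      fix e x
      have eq: "(graph_fun_scale (a d) (c d) + graph_fun_scale (b d) (q d)) e x =
          (if d = e then f e x else 0)" for d
        by (auto simp: f graph_fun_scale_def c_def q_def graph_osc_def osc_def)
      show "f e x = (\<Sum>d\<in>arcs G. graph_fun_scale (a d) (c d) + graph_fun_scale (b d) (q d)) e x"
        unfolding sum_graph_fun_apply eq using finite_arcs by (simp add: f graph_osc_def)
    qed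
    moreover have "graph_fun_scale (a d) (c d) + graph_fun_scale (b d) (q d) \<in> graph_fun.span ?T"
      if "d \<in> arcs G" for d
      using that by (intro graph_fun.span_add graph_fun.span_scale graph_fun.span_base) auto
    ultimately show "f \<in> graph_fun.span ?T" by (auto intro: graph_fun.span_sum)
  qed
  obtain B where B: "B \<subseteq> ?E" "graph_fun.independent B" "?E \<subseteq> graph_fun.span B"
    "card B = graph_fun.dim ?E"
    using graph_fun.basis_exists by blast
  have "finite B"
    using graph_fun.independent_span_bound[of ?T B] B(1,2) \<open>?E \<subseteq> graph_fun.span ?T\<close> by auto
  moreover have "B \<noteq> {}"
  proof
    assume "B = {}"
    then have "?E \<subseteq> {0}" using B(3) by simp
    then show False using assms unfolding is_eigenvalue_def by blast
  qed
  ultimately have "0 < card B" by (simp add: card_gt_0_iff)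
  then show ?thesis unfolding multiplicity_def B(4)[symmetric] by simp
qed

end


section \<open>Only finitely many eigenvalues below a bound\<close>

lemma finite_family_convergent_subsequence:
  fixes x :: "nat \<Rightarrow> 'i \<Rightarrow> 'a::heine_borel"
  assumes "finite I" "\<And>i. i \<in> I \<Longrightarrow> bounded (range (\<lambda>n. x n i))"
  shows "\<exists>r l. strict_mono (r :: nat \<Rightarrow> nat) \<and> (\<forall>i\<in>I. (\<lambda>n. x (r n) i) \<longlonglongrightarrow> l i)"
  using assms
proof (induction rule: finite_induct)
  case empty
  show ?case by (auto intro: exI[of _ "\<lambda>n. n"] simp: strict_mono_def)
next
  case (insert i I)
  then obtain r l where r: "strict_mono (r :: nat \<Rightarrow> nat)" "\<forall>j\<in>I. (\<lambda>n. x (r n) j) \<longlonglongrightarrow> l j" by auto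
  have "bounded (range (\<lambda>n. x (r n) i))"
    using insert.prems[of i] by (rule bounded_subset) auto
  then obtain l' r' where r': "strict_mono (r' :: nat \<Rightarrow> nat)" "((\<lambda>n. x (r n) i) \<circ> r') \<longlonglongrightarrow> l'"
    using bounded_imp_convergent_subsequence by blast
  have "(\<lambda>n. x ((r \<circ> r') n) j) \<longlonglongrightarrow> (l(i := l')) j" if "j \<in> insert i I" for j
  proof (cases "j = i")
    case True
    then show ?thesis using r'(2) by (simp add: o_def)
  next
    case False
    then have "(\<lambda>n. x (r n) j) \<longlonglongrightarrow> l j" using that r(2) by blast
    from LIMSEQ_subseq_LIMSEQ[OF this r'(1)] show ?thesis using False by (simp add: o_def)
  qed
  moreover have "strict_mono (r \<circ> r')" using r(1) r'(1) by (rule strict_mono_o)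
  ultimately show ?case by blast
qed

lemma osc_bound:
  assumes "x \<in> {0..l}"
  shows "cmod (osc s a b x) \<le> cmod a + cmod b * l"
proof -
  have "cmod (osc s a b x) \<le> cmod a * \<bar>cos (s * x)\<bar> + cmod b * \<bar>sin_quot s x\<bar>"
    unfolding osc_def by (rule norm_triangle_le) (simp add: norm_mult)
  also have "\<dots> \<le> cmod a * 1 + cmod b * l"
    using assms sin_quot_bound[of s x] by (intro add_mono mult_left_mono) auto
  finally show ?thesis by simp
qed

lemma continuous_on_osc: "continuous_on S (osc s a b)"
  by (rule continuous_on_of_vector_derivative[OF osc_derivs(1)])

lemma tendsto_integral_osc:
  assumes s: "s \<longlonglongrightarrow> \<sigma>" and a: "a \<longlonglongrightarrow> \<alpha>" and b: "b \<longlonglongrightarrow> \<beta>"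
    and bound: "\<And>n. cmod (a n) \<le> 1" "\<And>n. cmod (b n) \<le> 1"
    and h: "continuous_on {0..l} h" and l: "0 \<le> l"
  shows "(\<lambda>n. integral {0..l} (\<lambda>x. osc (s n) (a n) (b n) x * h x)) \<longlonglongrightarrow>
    integral {0..l} (\<lambda>x. osc \<sigma> \<alpha> \<beta> x * h x)"
proof (rule dominated_convergence(2))
  show "(\<lambda>x. osc (s n) (a n) (b n) x * h x) integrable_on {0..l}" for n
    by (intro integrable_continuous_real continuous_intros continuous_on_osc h)
  show "(\<lambda>x. (1 + l) * cmod (h x)) integrable_on {0..l}"
    by (intro integrable_continuous_real continuous_intros h)
  show "cmod (osc (s n) (a n) (b n) x * h x) \<le> (1 + l) * cmod (h x)" if x: "x \<in> {0..l}" for n x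
  proof -
    have "cmod (b n) * l \<le> 1 * l" using bound(2) l by (rule mult_right_mono)
    then have "cmod (osc (s n) (a n) (b n) x) \<le> 1 + l"
      using osc_bound[OF x, of "s n" "a n" "b n"] bound(1)[of n] by linarith
    then show ?thesis unfolding norm_mult by (rule mult_right_mono) simp
  qed
  show "(\<lambda>n. osc (s n) (a n) (b n) x * h x) \<longlonglongrightarrow> osc \<sigma> \<alpha> \<beta> x * h x" for x
    unfolding osc_def by (intro tendsto_intros a b s tendsto_sin_quot)
qed

context metric_graph
begin

lemma standing_wave_scale:
  assumes "standing_wave G L s a b"
  shows "standing_wave G L s (\<lambda>e. c * a e) (\<lambda>e. c * b e)"
proof -
  obtain \<phi> where \<phi>: "\<forall>e\<in>arcs G. \<phi> (tail G e) = a e \<and> \<phi> (head G e) = osc s (a e) (b e) (L e)"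
    using assms unfolding standing_wave_def by blast
  then have "\<forall>e\<in>arcs G. c * \<phi> (tail G e) = c * a e \<and> c * \<phi> (head G e) = osc s (c * a e) (c * b e) (L e)"
    by (simp add: osc_scale)
  then have "\<exists>\<psi>. \<forall>e\<in>arcs G. \<psi> (tail G e) = c * a e \<and> \<psi> (head G e) = osc s (c * a e) (c * b e) (L e)"
    by (intro exI[of _ "\<lambda>v. c * \<phi> v"])
  moreover have "\<forall>v\<in>verts G. (\<Sum>e | e \<in> arcs G \<and> head G e = v. osc' s (c * a e) (c * b e) (L e)) -
                   (\<Sum>e | e \<in> arcs G \<and> tail G e = v. c * b e) = 0"
    using assms unfolding standing_wave_def osc_scale sum_distrib_left[symmetric]
      right_diff_distrib[symmetric] by simp
  ultimately show ?thesis unfolding standing_wave_def by blast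
qed

text \<open>
  Green's identity: the derivative of \<open>F' cnj H - F cnj H'\<close> is \<open>(s'\<^sup>2 - s\<^sup>2) F cnj H\<close>, and the boundary
  terms cancel.
\<close>

lemma standing_waves_orthogonal:
  assumes w: "standing_wave G L s a b" and w': "standing_wave G L s' a' b'" and ne: "s\<^sup>2 \<noteq> s'\<^sup>2"
  shows "(\<Sum>e\<in>arcs G. integral {0..L e} (\<lambda>x. osc s (a e) (b e) x * cnj (osc s' (a' e) (b' e) x))) = 0"
proof -
  define F where "F e = osc s (a e) (b e)" for e
  define F' where "F' e = osc' s (a e) (b e)" for e
  define H where "H e = osc s' (a' e) (b' e)" for e
  define H' where "H' e = osc' s' (a' e) (b' e)" for e
  have der: "(F e has_vector_derivative F' e x) (at x within S)"
      "(F' e has_vector_derivative - ((of_real s)\<^sup>2 * F e x)) (at x within S)"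
      "(H e has_vector_derivative H' e x) (at x within S)"
      "(H' e has_vector_derivative - ((of_real s')\<^sup>2 * H e x)) (at x within S)" for e x S
    unfolding F_def F'_def H_def H'_def using osc_derivs by blast+
  obtain \<phi> where \<phi>: "\<forall>e\<in>arcs G. \<phi> (tail G e) = a e \<and> \<phi> (head G e) = F e (L e)"
    using w unfolding standing_wave_def F_def by blast
  obtain \<psi> where \<psi>: "\<forall>e\<in>arcs G. \<psi> (tail G e) = a' e \<and> \<psi> (head G e) = H e (L e)"
    using w' unfolding standing_wave_def H_def by blast
  define z where "z = complex_of_real (s'\<^sup>2 - s\<^sup>2)"
  let ?I = "\<lambda>e. integral {0..L e} (\<lambda>x. F e x * cnj (H e x))"
  let ?W = "\<lambda>e x. F' e x * cnj (H e x) - F e x * cnj (H' e x)"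
  have "z * ?I e = (\<psi>c (head G e) * F' e (L e) - \<psi>c (tail G e) * F' e 0) -
      (\<phi> (head G e) * cnj (H' e (L e)) - \<phi> (tail G e) * cnj (H' e 0))"
    if e: "e \<in> arcs G" and c: "\<psi>c = (\<lambda>v. cnj (\<psi> v))" for e \<psi>c
  proof -
    have "((\<lambda>x. z * (F e x * cnj (H e x))) has_integral (?W e (L e) - ?W e 0)) {0..L e}"
    proof (rule fundamental_theorem_of_calculus)
      fix x
      have "(?W e has_vector_derivative
         (F' e x * cnj (H' e x) + - ((of_real s)\<^sup>2 * F e x) * cnj (H e x)) -
         (F e x * cnj (- ((of_real s')\<^sup>2 * H e x)) + F' e x * cnj (H' e x))) (at x within {0..L e})"
        by (intro has_vector_derivative_diff has_vector_derivative_mult has_vector_derivative_cnj der)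
      then show "(?W e has_vector_derivative z * (F e x * cnj (H e x))) (at x within {0..L e})"
        by (simp add: z_def algebra_simps)
    qed (use length_pos[OF e] in simp)
    then have "integral {0..L e} (\<lambda>x. z * (F e x * cnj (H e x))) = ?W e (L e) - ?W e 0"
      by (rule integral_unique)
    then have "z * ?I e = ?W e (L e) - ?W e 0" unfolding integral_mult_right .
    moreover have "F e 0 = \<phi> (tail G e)" "H e 0 = \<psi> (tail G e)" "F e (L e) = \<phi> (head G e)"
      "H e (L e) = \<psi> (head G e)"
      using \<phi> \<psi> e by (auto simp: F_def H_def)
    ultimately show ?thesis unfolding c by (simp add: algebra_simps)
  qed
  then have "z * (\<Sum>e\<in>arcs G. ?I e) =
      (\<Sum>e\<in>arcs G. cnj (\<psi> (head G e)) * F' e (L e) - cnj (\<psi> (tail G e)) * F' e 0) -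
      (\<Sum>e\<in>arcs G. \<phi> (head G e) * cnj (H' e (L e)) - \<phi> (tail G e) * cnj (H' e 0))"
    unfolding sum_distrib_left sum_subtractf[symmetric] by (intro sum.cong) auto
  also have "(\<Sum>e\<in>arcs G. cnj (\<psi> (head G e)) * F' e (L e) - cnj (\<psi> (tail G e)) * F' e 0) = 0"
    by (rule boundary_sum[where \<phi> = "\<lambda>v. cnj (\<psi> v)"])
      (use w in \<open>auto simp: standing_wave_def F'_def\<close>)
  also have "(\<Sum>e\<in>arcs G. \<phi> (head G e) * cnj (H' e (L e)) - \<phi> (tail G e) * cnj (H' e 0)) = 0"
  proof (rule boundary_sum)
    fix v assume "v \<in> verts G"
    then have "(\<Sum>e | e \<in> arcs G \<and> head G e = v. H' e (L e)) - (\<Sum>e | e \<in> arcs G \<and> tail G e = v. H' e 0) = 0"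
      using w' by (simp add: standing_wave_def H'_def)
    then have "cnj ((\<Sum>e | e \<in> arcs G \<and> head G e = v. H' e (L e)) - (\<Sum>e | e \<in> arcs G \<and> tail G e = v. H' e 0)) = 0"
      by simp
    then show "(\<Sum>e | e \<in> arcs G \<and> head G e = v. cnj (H' e (L e))) -
        (\<Sum>e | e \<in> arcs G \<and> tail G e = v. cnj (H' e 0)) = 0"
      by (simp add: cnj_sum)
  qed
  finally have "z = 0 \<or> (\<Sum>e\<in>arcs G. ?I e) = 0" by simp
  moreover have "z \<noteq> 0" using ne by (simp add: z_def flip: of_real_power)
  ultimately show ?thesis unfolding F_def H_def by blast
qed

text \<open>
  Infinitely many frequencies in a bounded interval would give standing waves whose initial data,
  normalised to have norm \<open>1\<close>, converge along a subsequence. Every wave of the subsequence is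
  orthogonal to all others, hence to the limit, hence the limit is orthogonal to itself and vanishes,
  whereas its initial data still have norm \<open>1\<close>.
\<close>

lemma finite_frequencies:
  "finite {s. 0 \<le> s \<and> s \<le> R \<and> is_eigenvalue G L (s\<^sup>2)}" (is "finite ?M")
proof (rule ccontr)
  assume "infinite ?M"
  then obtain t :: "nat \<Rightarrow> real" where t: "inj t" "range t \<subseteq> ?M"
    using infinite_countable_subset by blast
  have "\<exists>a b. standing_wave G L (t n) a b \<and> (\<Sum>e\<in>arcs G. cmod (a e) + cmod (b e)) = 1" for n
  proof -
    have "is_eigenvalue G L ((t n)\<^sup>2)" using t(2) by blast
    then obtain a b where ab: "standing_wave G L (t n) a b" "\<exists>e\<in>arcs G. a e \<noteq> 0 \<or> b e \<noteq> 0"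
      unfolding is_eigenvalue_square_iff by blast
    define N where "N = (\<Sum>e\<in>arcs G. cmod (a e) + cmod (b e))"
    have "N > 0"
    proof -
      obtain e where e: "e \<in> arcs G" "a e \<noteq> 0 \<or> b e \<noteq> 0" using ab(2) by blast
      then have "0 < cmod (a e) + cmod (b e)" by (auto intro: add_pos_nonneg add_nonneg_pos)
      also have "\<dots> \<le> N" unfolding N_def using e(1) by (intro member_le_sum) auto
      finally show ?thesis .
    qed
    have "(\<Sum>e\<in>arcs G. cmod (of_real (1 / N) * a e) + cmod (of_real (1 / N) * b e)) = (1 / N) * N"
      unfolding N_def sum_distrib_left using \<open>N > 0\<close>
      by (intro sum.cong refl) (simp add: norm_mult norm_divide field_simps flip: N_def)
    also have "\<dots> = 1" using \<open>N > 0\<close> by simp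
    finally show ?thesis using standing_wave_scale[OF ab(1), of "of_real (1 / N)"] by blast
  qed
  then obtain a b where w: "\<And>n. standing_wave G L (t n) (a n) (b n)"
    and norm1: "\<And>n. (\<Sum>e\<in>arcs G. cmod (a n e) + cmod (b n e)) = 1" by metis
  have bnd: "cmod (a n e) \<le> 1" "cmod (b n e) \<le> 1" if "e \<in> arcs G" for n e
  proof -
    have "cmod (a n e) + cmod (b n e) \<le> 1"
      unfolding norm1[of n, symmetric] using that by (intro member_le_sum) auto
    then show "cmod (a n e) \<le> 1" "cmod (b n e) \<le> 1"
      using norm_ge_zero[of "a n e"] norm_ge_zero[of "b n e"] by linarith+
  qed
  \<comment> \<open>frequencies and initial data as one finite family, so that a single subsequence serves all of them\<close>
  define x where "x n i = (case i of None \<Rightarrow> complex_of_real (t n) | Some (e, c) \<Rightarrow> if c then a n e else b n e)"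
    for n and i :: "('e \<times> bool) option"
  have "\<exists>r l. strict_mono (r :: nat \<Rightarrow> nat) \<and>
      (\<forall>i\<in>insert None (Some ` (arcs G \<times> UNIV)). (\<lambda>n. x (r n) i) \<longlonglongrightarrow> l i)"
  proof (rule finite_family_convergent_subsequence)
    fix i assume i: "i \<in> insert None (Some ` (arcs G \<times> (UNIV :: bool set)))"
    have "cmod (x n i) \<le> max 1 \<bar>R\<bar>" for n
    proof (cases i)
      case None
      have "0 \<le> t n" "t n \<le> R" using t(2) by auto
      then show ?thesis using None by (simp add: x_def)
    next
      case (Some p)
      then show ?thesis using i bnd by (auto simp: x_def le_max_iff_disj)
    qed
    then show "bounded (range (\<lambda>n. x n i))" by (auto intro: boundedI)
  qed simp
  then obtain r l where r: "strict_mono (r :: nat \<Rightarrow> nat)"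
    and l: "\<And>i. i \<in> insert None (Some ` (arcs G \<times> UNIV)) \<Longrightarrow> (\<lambda>n. x (r n) i) \<longlonglongrightarrow> l i" by blast
  define \<sigma> where "\<sigma> = Re (l None)"
  define \<alpha> where "\<alpha> e = l (Some (e, True))" for e
  define \<beta> where "\<beta> e = l (Some (e, False))" for e
  have \<sigma>: "(\<lambda>n. t (r n)) \<longlonglongrightarrow> \<sigma>"
    using tendsto_Re[OF l[of None]] by (simp add: x_def \<sigma>_def)
  have \<alpha>: "(\<lambda>n. a (r n) e) \<longlonglongrightarrow> \<alpha> e" and \<beta>: "(\<lambda>n. b (r n) e) \<longlonglongrightarrow> \<beta> e" if "e \<in> arcs G" for e
    using l[of "Some (e, True)"] l[of "Some (e, False)"] that by (auto simp: x_def \<alpha>_def \<beta>_def)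
  let ?F = "\<lambda>n e. osc (t (r n)) (a (r n) e) (b (r n) e)" and ?Lim = "\<lambda>e. osc \<sigma> (\<alpha> e) (\<beta> e)"
  have conv: "(\<lambda>n. \<Sum>e\<in>arcs G. integral {0..L e} (\<lambda>x. ?F n e x * h e x)) \<longlonglongrightarrow>
      (\<Sum>e\<in>arcs G. integral {0..L e} (\<lambda>x. ?Lim e x * h e x))"
    if "\<And>e. continuous_on {0..L e} (h e)" for h
    by (intro tendsto_sum tendsto_integral_osc)
      (use \<sigma> \<alpha> \<beta> bnd that length_pos in \<open>auto simp: less_imp_le\<close>)
  have orth: "(\<Sum>e\<in>arcs G. integral {0..L e} (\<lambda>x. ?F n e x * cnj (?F m e x))) = 0" if "n \<noteq> m" for n m
  proof (rule standing_waves_orthogonal[OF w w])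
    have "t (r n) \<noteq> t (r m)" using that t(1) strict_mono_eq[OF r] by (simp add: inj_eq)
    moreover have "0 \<le> t (r n)" "0 \<le> t (r m)" using t(2) by auto
    ultimately show "(t (r n))\<^sup>2 \<noteq> (t (r m))\<^sup>2" by (simp add: power2_eq_iff_nonneg)
  qed
  have zero_limit: "S = 0" if "X \<longlonglongrightarrow> S" "\<And>n. n > m \<Longrightarrow> X n = 0" for X :: "nat \<Rightarrow> complex" and S m
  proof -
    have "\<forall>\<^sub>F n in sequentially. X n = 0" using eventually_gt_at_top[of m] by eventually_elim (rule that(2))
    then have "X \<longlonglongrightarrow> 0" by (rule tendsto_eventually)
    then show ?thesis using that(1) LIMSEQ_unique by blast
  qed
  have cnj_cont: "continuous_on S (\<lambda>x. cnj (osc s a b x))" for S s a b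
    by (intro continuous_intros continuous_on_osc)
  have int: "(\<lambda>x. (cmod (?Lim e x))\<^sup>2) integrable_on {0..L e}" for e
    by (intro integrable_continuous_real continuous_intros continuous_on_osc)
  \<comment> \<open>the first of the two limits in the inner product\<close>
  have orth0: "(\<Sum>e\<in>arcs G. integral {0..L e} (\<lambda>x. ?Lim e x * cnj (?F m e x))) = 0" for m
    by (rule zero_limit[OF conv[of "\<lambda>e x. cnj (?F m e x)"], of m]) (use orth cnj_cont in auto)
  have "(\<Sum>e\<in>arcs G. integral {0..L e} (\<lambda>x. ?F m e x * cnj (?Lim e x))) = 0" for m
  proof -
    have "integral {0..L e} (cnj \<circ> (\<lambda>x. ?Lim e x * cnj (?F m e x))) =
        cnj (integral {0..L e} (\<lambda>x. ?Lim e x * cnj (?F m e x)))" for e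
      by (intro integral_linear bounded_linear_cnj integrable_continuous_real continuous_on_mult
          continuous_on_osc cnj_cont)
    then have "(\<Sum>e\<in>arcs G. integral {0..L e} (\<lambda>x. ?F m e x * cnj (?Lim e x))) =
        cnj (\<Sum>e\<in>arcs G. integral {0..L e} (\<lambda>x. ?Lim e x * cnj (?F m e x)))"
      unfolding cnj_sum by (simp add: o_def mult.commute)
    then show ?thesis using orth0 by simp
  qed
  then have "(\<Sum>e\<in>arcs G. integral {0..L e} (\<lambda>x. ?Lim e x * cnj (?Lim e x))) = 0"
    using zero_limit[OF conv[of "\<lambda>e x. cnj (?Lim e x)"], of 0] cnj_cont by simp
  moreover have "integral {0..L e} (\<lambda>x. ?Lim e x * cnj (?Lim e x)) =
      of_real (integral {0..L e} (\<lambda>x. (cmod (?Lim e x))\<^sup>2))" for e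
    using integral_linear[OF int bounded_linear_of_real[where 'a = complex], of e]
    by (simp add: o_def complex_norm_square del: of_real_power)
  ultimately have "complex_of_real (\<Sum>e\<in>arcs G. integral {0..L e} (\<lambda>x. (cmod (?Lim e x))\<^sup>2)) = 0"
    by simp
  then have sum0: "(\<Sum>e\<in>arcs G. integral {0..L e} (\<lambda>x. (cmod (?Lim e x))\<^sup>2)) = 0"
    unfolding of_real_eq_0_iff .
  have int0: "integral {0..L e} (\<lambda>x. (cmod (?Lim e x))\<^sup>2) = 0" if "e \<in> arcs G" for e
    using sum0 that sum_nonneg_eq_0_iff[of "arcs G" "\<lambda>e. integral {0..L e} (\<lambda>x. (cmod (?Lim e x))\<^sup>2)"]
    by (simp add: integral_nonneg int)
  have lim0: "\<alpha> e = 0 \<and> \<beta> e = 0" if e: "e \<in> arcs G" for e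
  proof -
    have "?Lim e x = 0" if x: "x \<in> {0..L e}" for x
    proof -
      have "((\<lambda>x. (cmod (?Lim e x))\<^sup>2) has_integral 0) (cbox 0 (L e))"
        using integrable_integral[OF int, of e] int0[OF e] by simp
      then have "(cmod (?Lim e x))\<^sup>2 = 0"
        by (rule has_integral_0_cbox_imp_0[rotated 2])
          (use x length_pos[OF e] in \<open>auto intro!: continuous_intros continuous_on_osc\<close>)
      then show ?thesis by simp
    qed
    then show ?thesis using osc_eq_0_imp length_pos[OF e] by blast
  qed
  have "(\<lambda>n. \<Sum>e\<in>arcs G. cmod (a (r n) e) + cmod (b (r n) e)) \<longlonglongrightarrow>
      (\<Sum>e\<in>arcs G. cmod (\<alpha> e) + cmod (\<beta> e))"
    by (intro tendsto_intros \<alpha> \<beta>)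
  then have "(\<Sum>e\<in>arcs G. cmod (\<alpha> e) + cmod (\<beta> e)) = 1"
    unfolding norm1 by (simp add: LIMSEQ_const_iff)
  then show False using lim0 by simp
qed

lemma finite_eigenvalues: "finite {\<mu>. is_eigenvalue G L \<mu> \<and> \<mu> \<le> t}"
proof (rule finite_subset)
  show "{\<mu>. is_eigenvalue G L \<mu> \<and> \<mu> \<le> t} \<subseteq>
    (\<lambda>s. s\<^sup>2) ` {s. 0 \<le> s \<and> s \<le> sqrt t \<and> is_eigenvalue G L (s\<^sup>2)}"
  proof
    fix \<mu> assume "\<mu> \<in> {\<mu>. is_eigenvalue G L \<mu> \<and> \<mu> \<le> t}"
    then show "\<mu> \<in> (\<lambda>s. s\<^sup>2) ` {s. 0 \<le> s \<and> s \<le> sqrt t \<and> is_eigenvalue G L (s\<^sup>2)}"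
      using is_eigenvalue_nonneg[of \<mu>] by (intro image_eqI[of _ _ "sqrt \<mu>"]) auto
  qed
qed (intro finite_imageI finite_frequencies)

text \<open>
  \<open>eigenval\<close> is the infimum of a set of real numbers, and such an infimum is a lower bound only if
  the set is bounded below; this is where the absence of negative eigenvalues enters.
\<close>

lemma eigenval_le:
  assumes S: "finite S" "\<And>\<mu>. \<mu> \<in> S \<Longrightarrow> is_eigenvalue G L \<mu> \<and> \<mu> \<le> t" "k \<le> card S" and k: "1 \<le> k"
  shows "eigenval G L k \<le> t"
  unfolding eigenval_def
proof (rule cInf_lower)
  have "card S = (\<Sum>\<mu>\<in>S. 1)" by simp
  also have "\<dots> \<le> (\<Sum>\<mu>\<in>S. multiplicity G L \<mu>)"
    using S(2) multiplicity_pos by (intro sum_mono) blast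
  also have "\<dots> \<le> eigenvalue_count G L t"
    unfolding eigenvalue_count_def using S(2) finite_eigenvalues by (intro sum_mono2) auto
  finally show "t \<in> {t. k \<le> eigenvalue_count G L t}" using S(3) by simp
  show "bdd_below {t. k \<le> eigenvalue_count G L t}"
  proof (rule bdd_belowI)
    fix u assume u: "u \<in> {t. k \<le> eigenvalue_count G L t}"
    show "0 \<le> u"
    proof (rule ccontr)
      assume "\<not> 0 \<le> u"
      then have "{\<mu>. is_eigenvalue G L \<mu> \<and> \<mu> \<le> u} = {}" using is_eigenvalue_nonneg by fastforce
      then have "eigenvalue_count G L u = 0" unfolding eigenvalue_count_def by (simp only: sum.empty)
      then show False using u k by simp
    qed
  qed
qed

end


section \<open>Frequencies in every window of length \<open>\<pi> / L e\<close>\<close>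

text \<open>
  While the imaginary part of \<open>(X + iY) exp (i l s)\<close> does not vanish, its argument stays in an open
  half-turn and can be measured by the arc tangent of the real part over the imaginary part. This
  function decreases faster than \<open>- l s\<close>, and its values lie in an interval of length \<open>\<pi>\<close>.
\<close>

lemma phase_gap:
  assumes inc: "phase_increasing X Y" and l: "0 < l" and pq: "p < q"
    and nz: "\<And>s. p < s \<Longrightarrow> s < q \<Longrightarrow> rotY l X Y s \<noteq> 0"
  shows "l * (q - p) < pi"
proof (rule ccontr)
  assume "\<not> ?thesis"
  then have long: "pi \<le> l * (q - p)" by simp
  obtain X' Y' where d: "\<And>s. (X has_real_derivative X' s) (at s)" "\<And>s. (Y has_real_derivative Y' s) (at s)"
    and pos: "\<And>s. X s \<noteq> 0 \<or> Y s \<noteq> 0 \<Longrightarrow> X s * Y' s - Y s * X' s > 0"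
    using inc unfolding phase_increasing_def by blast
  define P where "P = rotX l X Y"
  define F where "F = rotY l X Y"
  define P' where "P' s = X' s * cos (s * l) - Y' s * sin (s * l) - l * F s" for s
  define F' where "F' s = X' s * sin (s * l) + Y' s * cos (s * l) + l * P s" for s
  have dP: "(P has_real_derivative P' s) (at s)" for s
    unfolding P_def P'_def F_def rotX_def[abs_def] rotY_def
    by (rule derivative_eq_intros d refl)+ (simp add: algebra_simps)
  have dF: "(F has_real_derivative F' s) (at s)" for s
    unfolding P_def F'_def F_def rotY_def[abs_def] rotX_def
    by (rule derivative_eq_intros d refl)+ (simp add: algebra_simps)
  \<comment> \<open>the arc tangent without the part of its decrease that is due to the factor \<open>exp (i l s)\<close>\<close>
  define \<psi> where "\<psi> s = arctan (P s / F s) + l * s" for s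
  have dec: "\<psi> s' < \<psi> s" if "p < s" "s < s'" "s' < q" for s s'
  proof (rule DERIV_neg_imp_decreasing[OF that(2)])
    fix x assume "s \<le> x" "x \<le> s'"
    then have F: "F x \<noteq> 0" using nz that by (simp add: F_def)
    have N: "(P x)\<^sup>2 + (F x)\<^sup>2 = (X x)\<^sup>2 + (Y x)\<^sup>2" unfolding P_def F_def by (rule rot_norm)
    have Npos: "0 < (P x)\<^sup>2 + (F x)\<^sup>2" using F by (simp add: sum_power2_gt_zero_iff)
    have "P x * F' x - F x * P' x =
        (P x * (X' x * sin (x * l) + Y' x * cos (x * l)) - F x * (X' x * cos (x * l) - Y' x * sin (x * l))) +
        l * ((P x)\<^sup>2 + (F x)\<^sup>2)"
      unfolding F'_def P'_def by algebra
    also have "P x * (X' x * sin (x * l) + Y' x * cos (x * l)) - F x * (X' x * cos (x * l) - Y' x * sin (x * l)) =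
        (X x * Y' x - Y x * X' x) * ((sin (x * l))\<^sup>2 + (cos (x * l))\<^sup>2)"
      unfolding P_def F_def rotX_def rotY_def by algebra
    finally have wr: "P x * F' x - F x * P' x = (X x * Y' x - Y x * X' x) + l * ((P x)\<^sup>2 + (F x)\<^sup>2)"
      by simp
    have "X x \<noteq> 0 \<or> Y x \<noteq> 0" using Npos N by auto
    then have W: "0 < X x * Y' x - Y x * X' x" by (rule pos)
    have "(\<psi> has_real_derivative (inverse (1 + (P x / F x)\<^sup>2) * ((P' x * F x - P x * F' x) / (F x * F x)) + l)) (at x)"
      unfolding \<psi>_def[abs_def] using F
      by (auto intro!: derivative_eq_intros dP dF)
    moreover have "inverse (1 + (P x / F x)\<^sup>2) * ((P' x * F x - P x * F' x) / (F x * F x)) =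
        - (P x * F' x - F x * P' x) / ((P x)\<^sup>2 + (F x)\<^sup>2)"
    proof -
      have "1 + (P x / F x)\<^sup>2 = ((P x)\<^sup>2 + (F x)\<^sup>2) / (F x * F x)"
        using F by (simp add: field_simps power2_eq_square)
      moreover have "inverse (n / d) * (w / d) = w / n" if "d \<noteq> 0" for n d w :: real
        using that by simp
      ultimately show ?thesis using F by (simp add: mult.commute)
    qed
    moreover have "- (P x * F' x - F x * P' x) / ((P x)\<^sup>2 + (F x)\<^sup>2) + l =
        - ((X x * Y' x - Y x * X' x) / ((P x)\<^sup>2 + (F x)\<^sup>2))"
    proof -
      have "- (w + l * n) / n + l = - (w / n)" if "0 < n" for w n
        using that by (simp add: field_simps)
      from this[OF Npos] show ?thesis unfolding wr .
    qed
    ultimately have "(\<psi> has_real_derivative - ((X x * Y' x - Y x * X' x) / ((P x)\<^sup>2 + (F x)\<^sup>2))) (at x)"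
      by simp
    then show "\<exists>y. (\<psi> has_real_derivative y) (at x) \<and> y < 0"
      using W Npos by (intro exI conjI) auto
  qed
  define c1 where "c1 = p + (q - p) / 3"
  define c2 where "c2 = p + 2 * (q - p) / 3"
  have c: "p < c1" "c1 < c2" "c2 < q" using pq unfolding c1_def c2_def by (simp_all add: field_simps)
  define \<delta> where "\<delta> = \<psi> c1 - \<psi> c2"
  have \<delta>: "0 < \<delta>" using dec[OF c] by (simp add: \<delta>_def)
  \<comment> \<open>so close to the ends of the interval that less than \<open>\<delta>\<close> of the turn is lost there\<close>
  define \<eta> where "\<eta> = min ((q - p) / 6) (\<delta> / (4 * l))"
  have "0 < \<eta>" unfolding \<eta>_def using pq \<delta> l by simp
  moreover have "\<eta> \<le> (q - p) / 6" "\<eta> \<le> \<delta> / (4 * l)"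
    unfolding \<eta>_def by (rule min.cobounded1, rule min.cobounded2)
  ultimately have \<eta>: "0 < \<eta>" "\<eta> \<le> (q - p) / 6" "\<eta> \<le> \<delta> / (4 * l)" by blast+
  have \<eta>l: "l * \<eta> \<le> \<delta> / 4" using \<eta>(3) l by (simp add: field_simps)
  have "\<psi> c1 < \<psi> (p + \<eta>)" using \<eta> c by (intro dec) (auto simp: c1_def field_simps)
  moreover have "\<psi> (q - \<eta>) < \<psi> c2" using \<eta> c by (intro dec) (auto simp: c2_def field_simps)
  ultimately have "\<delta> < \<psi> (p + \<eta>) - \<psi> (q - \<eta>)" unfolding \<delta>_def by linarith
  also have "\<dots> = arctan (P (p + \<eta>) / F (p + \<eta>)) - arctan (P (q - \<eta>) / F (q - \<eta>)) - l * (q - p) + 2 * (l * \<eta>)"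
    unfolding \<psi>_def by (simp add: algebra_simps)
  also have "\<dots> < pi - pi + \<delta> / 2"
    using arctan_bounded[of "P (p + \<eta>) / F (p + \<eta>)"] arctan_bounded[of "P (q - \<eta>) / F (q - \<eta>)"]
      \<eta>l long by linarith
  finally show False using \<delta> by simp
qed

text \<open>
  Arguments add under complex multiplication; one factor with increasing phase suffices if the other
  one is constant.
\<close>

lemma phase_increasing_mult:
  assumes 1: "phase_increasing X1 Y1 \<or> (X1 = (\<lambda>_. 1) \<and> Y1 = (\<lambda>_. 0))"
    and 2: "phase_increasing X2 Y2 \<or> (X2 = (\<lambda>_. 1) \<and> Y2 = (\<lambda>_. 0))"
    and nontrivial: "phase_increasing X1 Y1 \<or> phase_increasing X2 Y2"
  shows "phase_increasing (\<lambda>s. X1 s * X2 s - Y1 s * Y2 s) (\<lambda>s. X1 s * Y2 s + Y1 s * X2 s)"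
proof (cases "phase_increasing X1 Y1 \<and> phase_increasing X2 Y2")
  case False
  then show ?thesis using assms by auto
next
  case True
  then obtain X1' Y1' X2' Y2' where
    d: "\<And>s. (X1 has_real_derivative X1' s) (at s)" "\<And>s. (Y1 has_real_derivative Y1' s) (at s)"
      "\<And>s. (X2 has_real_derivative X2' s) (at s)" "\<And>s. (Y2 has_real_derivative Y2' s) (at s)"
    and p1: "\<And>s. X1 s \<noteq> 0 \<or> Y1 s \<noteq> 0 \<Longrightarrow> X1 s * Y1' s - Y1 s * X1' s > 0"
    and p2: "\<And>s. X2 s \<noteq> 0 \<or> Y2 s \<noteq> 0 \<Longrightarrow> X2 s * Y2' s - Y2 s * X2' s > 0"
    unfolding phase_increasing_def by blast
  define P where "P s = X1' s * X2 s + X1 s * X2' s - (Y1' s * Y2 s + Y1 s * Y2' s)" for s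
  define Q where "Q s = X1' s * Y2 s + X1 s * Y2' s + (Y1' s * X2 s + Y1 s * X2' s)" for s
  have "((\<lambda>s. X1 s * X2 s - Y1 s * Y2 s) has_real_derivative P s) (at s)" for s
    unfolding P_def by (rule derivative_eq_intros d refl)+ (simp add: algebra_simps)
  moreover have "((\<lambda>s. X1 s * Y2 s + Y1 s * X2 s) has_real_derivative Q s) (at s)" for s
    unfolding Q_def by (rule derivative_eq_intros d refl)+ (simp add: algebra_simps)
  moreover have "(X1 s * X2 s - Y1 s * Y2 s) * Q s - (X1 s * Y2 s + Y1 s * X2 s) * P s > 0"
    if nz: "X1 s * X2 s - Y1 s * Y2 s \<noteq> 0 \<or> X1 s * Y2 s + Y1 s * X2 s \<noteq> 0" for s
  proof -
    have "(X1 s * X2 s - Y1 s * Y2 s) * Q s - (X1 s * Y2 s + Y1 s * X2 s) * P s =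
      ((X2 s)\<^sup>2 + (Y2 s)\<^sup>2) * (X1 s * Y1' s - Y1 s * X1' s) +
      ((X1 s)\<^sup>2 + (Y1 s)\<^sup>2) * (X2 s * Y2' s - Y2 s * X2' s)"
      unfolding P_def Q_def by algebra
    moreover have n: "X1 s \<noteq> 0 \<or> Y1 s \<noteq> 0" "X2 s \<noteq> 0 \<or> Y2 s \<noteq> 0" using nz by auto
    moreover have "0 < (X1 s)\<^sup>2 + (Y1 s)\<^sup>2" "0 < (X2 s)\<^sup>2 + (Y2 s)\<^sup>2"
      using n by (simp_all add: sum_power2_gt_zero_iff)
    ultimately show ?thesis using p1[OF n(1)] p2[OF n(2)] by (simp add: add_pos_pos)
  qed
  ultimately show ?thesis unfolding phase_increasing_def by blast
qed

context metric_graph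
begin

text \<open>
  The slope of \<open>b sin (s x)\<close> at \<open>0\<close> is \<open>s b\<close>, whence the factor between the two descriptions of a
  wave.
\<close>

lemma wave_imp_eigenvalue:
  assumes s: "s \<noteq> 0" and w: "wave G L s v (verts G) (arcs G) \<phi> a b"
    and root: "flux G L s (arcs G) a b v = 0" and nz: "\<exists>e\<in>arcs G. a e \<noteq> 0 \<or> b e \<noteq> 0"
  shows "is_eigenvalue G L (s\<^sup>2)"
proof -
  define a' where "a' e = complex_of_real (a e)" for e
  define b' where "b' e = complex_of_real (s * b e)" for e
  have o: "osc s (a' e) (b' e) x = of_real (a e * cos (s * x) + b e * sin (s * x))" for e x
    unfolding osc_def a'_def b'_def of_real_mult[symmetric] of_real_add[symmetric]
    by (simp flip: mult_sin_quot add: algebra_simps)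
  have o': "osc' s (a' e) (b' e) x = of_real (s * (b e * cos (s * x) - a e * sin (s * x)))" for e x
    unfolding osc'_def a'_def b'_def by (simp add: algebra_simps)
  have "standing_wave G L s a' b'"
    unfolding standing_wave_def
  proof (intro conjI ballI)
    have "\<forall>e\<in>arcs G. of_real (\<phi> (tail G e)) = a' e \<and> of_real (\<phi> (head G e)) = osc s (a' e) (b' e) (L e)"
      unfolding o using w by (simp add: wave_def a'_def)
    then show "\<exists>\<phi>. \<forall>e\<in>arcs G. \<phi> (tail G e) = a' e \<and> \<phi> (head G e) = osc s (a' e) (b' e) (L e)"
      by (intro exI[of _ "\<lambda>v. of_real (\<phi> v)"])
    fix u assume "u \<in> verts G"
    then have f: "flux G L s (arcs G) a b u = 0" using w root unfolding wave_def by blast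
    have "(\<Sum>e | e \<in> arcs G \<and> head G e = u. osc' s (a' e) (b' e) (L e)) -
        (\<Sum>e | e \<in> arcs G \<and> tail G e = u. b' e) = of_real (s * flux G L s (arcs G) a b u)"
      unfolding flux_def sum_distrib_left of_real_sum o' sum.inter_filter[OF finite_arcs]
        sum_subtractf[symmetric]
      unfolding b'_def by (intro sum.cong refl) (simp add: algebra_simps)
    then show "(\<Sum>e | e \<in> arcs G \<and> head G e = u. osc' s (a' e) (b' e) (L e)) -
        (\<Sum>e | e \<in> arcs G \<and> tail G e = u. b' e) = 0" unfolding f by simp
  qed
  moreover have "\<exists>e\<in>arcs G. a' e \<noteq> 0 \<or> b' e \<noteq> 0" using nz s by (simp add: a'_def b'_def)
  ultimately show ?thesis unfolding is_eigenvalue_square_iff by blast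
qed

text \<open>
  The remaining Kirchhoff condition at the root, \<open>Y1 x + X1 y = 0\<close> for the rotated data \<open>(x, y)\<close> of
  the second tree, is the vanishing of the imaginary part of
  \<open>(X1 + iY1) (X2 + iY2) exp (i s L e)\<close>.
\<close>

lemma frequency_in_window:
  assumes tree: "undirected_tree G" and e: "e \<in> arcs G" and more: "arcs G \<noteq> {e}" and s0: "0 \<le> s0"
  shows "\<exists>s. s0 < s \<and> s < s0 + pi / L e \<and> is_eigenvalue G L (s\<^sup>2)"
proof -
  obtain U W A B where T: "rooted_tree G (tail G e) U A" "rooted_tree G (head G e) W B"
    "U \<inter> W = {}" "U \<union> W = verts G" "arcs G = insert e (A \<union> B)"
    using tree_decomposition_at_arc[OF tree e] .
  have l: "0 < L e" using length_pos[OF e] .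
  have LA: "\<And>d. d \<in> A \<Longrightarrow> 0 < L d" and LB: "\<And>d. d \<in> B \<Longrightarrow> 0 < L d" using T(5) length_pos by auto
  obtain X1 Y1 where 1: "root_data G L (tail G e) U A X1 Y1"
    "if A = {} then X1 = (\<lambda>_. 1) \<and> Y1 = (\<lambda>_. 0) else phase_increasing X1 Y1"
    using rooted_tree_root_data[where L = L, OF T(1) LA] by blast
  obtain X2 Y2 where 2: "root_data G L (head G e) W B X2 Y2"
    "if B = {} then X2 = (\<lambda>_. 1) \<and> Y2 = (\<lambda>_. 0) else phase_increasing X2 Y2"
    using rooted_tree_root_data[where L = L, OF T(2) LB] by blast
  have "A \<noteq> {} \<or> B \<noteq> {}" using more T(5) by auto
  then have inc: "phase_increasing (\<lambda>s. X1 s * X2 s - Y1 s * Y2 s) (\<lambda>s. X1 s * Y2 s + Y1 s * X2 s)"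
    using 1(2) 2(2) by (intro phase_increasing_mult) (auto split: if_splits)
  have "L e * (s0 + pi / L e - s0) = pi" using l by simp
  then obtain s where s: "s0 < s" "s < s0 + pi / L e"
    and zero: "rotY (L e) (\<lambda>s. X1 s * X2 s - Y1 s * Y2 s) (\<lambda>s. X1 s * Y2 s + Y1 s * X2 s) s = 0"
    using phase_gap[OF inc l, of s0 "s0 + pi / L e"] l by fastforce
  have s_nz: "s \<noteq> 0" using s(1) s0 by simp
  let ?X = "X1 s * rotX (L e) X2 Y2 s" and ?Y = "Y1 s * rotX (L e) X2 Y2 s + X1 s * rotY (L e) X2 Y2 s"
  have Y: "?Y = 0" using zero by (simp add: rotX_def rotY_def algebra_simps)
  have "joins G e (tail G e) (head G e)" by (simp add: joins_def)
  from root_data_graft[OF T(1-3) this 1(1) 2(1)]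
  have data: "root_data G L (tail G e) (verts G) (arcs G) (\<lambda>s. X1 s * rotX (L e) X2 Y2 s)
      (\<lambda>s. Y1 s * rotX (L e) X2 Y2 s + X1 s * rotY (L e) X2 Y2 s)"
    unfolding T(4) T(5)[symmetric] .
  have "is_eigenvalue G L (s\<^sup>2)"
  proof (cases "?X = 0")
    case True
    then have "trapped_wave G L s (tail G e) (verts G) (arcs G)"
      using data Y unfolding root_data_def by blast
    then show ?thesis using wave_imp_eigenvalue[OF s_nz] unfolding trapped_wave_def by blast
  next
    case False
    obtain \<phi> a b where w: "wave G L s (tail G e) (verts G) (arcs G) \<phi> a b" "\<phi> (tail G e) = ?X"
      "flux G L s (arcs G) a b (tail G e) = - ?Y"
      using data unfolding root_data_def by blast
    have "\<phi> (tail G e) = a e" using w(1) e unfolding wave_def by blast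
    then have "\<exists>d\<in>arcs G. a d \<noteq> 0 \<or> b d \<noteq> 0" using w(2) False e by metis
    moreover have "flux G L s (arcs G) a b (tail G e) = 0" unfolding w(3) Y by simp
    ultimately show ?thesis using wave_imp_eigenvalue[OF s_nz w(1)] by blast
  qed
  then show ?thesis using s by blast
qed

lemma eigenvalue_0: "is_eigenvalue G L 0"
proof -
  have "standing_wave G L 0 (\<lambda>_. 1) (\<lambda>_. 0)"
    unfolding standing_wave_def by (auto simp: osc_def osc'_def intro: exI[of _ "\<lambda>_. 1"])
  then have "is_eigenvalue G L (0\<^sup>2)"
    unfolding is_eigenvalue_square_iff using arcs_nonempty by (intro exI conjI) auto
  then show ?thesis by simp
qed

text \<open>
  These are the frequencies of \<open>cos (j \<pi> x / L e)\<close>. The tree has no loop, so continuity at the vertices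
  is no condition.
\<close>

lemma single_edge_frequencies:
  assumes tree: "undirected_tree G" and e: "arcs G = {e}"
  shows "is_eigenvalue G L ((real j * pi / L e)\<^sup>2)"
proof -
  have "e \<in> arcs G" using e by simp
  from tree_decomposition_at_arc[OF tree this]
  obtain U W A B where T: "rooted_tree G (tail G e) U A" "rooted_tree G (head G e) W B" "U \<inter> W = {}" .
  have ne: "tail G e \<noteq> head G e"
    using rooted_tree_root[OF T(1)] rooted_tree_root[OF T(2)] T(3) by auto
  have l: "0 < L e" using length_pos e by simp
  define s where "s = real j * pi / L e"
  have sl: "s * L e = real j * pi" using l by (simp add: s_def)
  have "standing_wave G L s (\<lambda>_. 1) (\<lambda>_. 0)"
    unfolding standing_wave_def
  proof (intro conjI ballI)
    show "\<exists>\<phi>. \<forall>d\<in>arcs G. \<phi> (tail G d) = (1::complex) \<and> \<phi> (head G d) = osc s 1 0 (L d)"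
      using ne e by (intro exI[of _ "\<lambda>v. if v = tail G e then 1 else osc s 1 0 (L e)"]) auto
    show "(\<Sum>d | d \<in> arcs G \<and> head G d = v. osc' s 1 0 (L d)) - (\<Sum>d | d \<in> arcs G \<and> tail G d = v. 0) = 0" for v
    proof -
      have "osc' s 1 0 (L d) = 0" if "d \<in> arcs G" for d
        using that e sl by (simp add: osc'_def sin_npi)
      then show ?thesis by simp
    qed
  qed
  then show ?thesis
    unfolding s_def[symmetric] is_eigenvalue_square_iff using e by (intro exI conjI) auto
qed

lemma eigenval_le_frequency:
  fixes \<sigma> :: "nat \<Rightarrow> real"
  assumes ev: "\<And>i. i \<le> k \<Longrightarrow> is_eigenvalue G L ((\<sigma> i)\<^sup>2)" and nonneg: "\<And>i. i \<le> k \<Longrightarrow> 0 \<le> \<sigma> i"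
    and mono: "\<And>i j. i < j \<Longrightarrow> j \<le> k \<Longrightarrow> \<sigma> i < \<sigma> j"
  shows "eigenval G L (k + 1) \<le> (\<sigma> k)\<^sup>2"
proof (rule eigenval_le)
  have "inj_on (\<lambda>i. (\<sigma> i)\<^sup>2) {..k}"
  proof (rule linorder_inj_onI)
    fix i j assume "i < j" "i \<in> {..k}" "j \<in> {..k}"
    then have "\<sigma> i < \<sigma> j" "0 \<le> \<sigma> i" using mono nonneg by auto
    then show "(\<sigma> i)\<^sup>2 \<noteq> (\<sigma> j)\<^sup>2" by (simp add: power2_eq_iff_nonneg)
  qed auto
  then show "k + 1 \<le> card ((\<lambda>i. (\<sigma> i)\<^sup>2) ` {..k})" by (simp add: card_image)
  fix \<mu> assume "\<mu> \<in> (\<lambda>i. (\<sigma> i)\<^sup>2) ` {..k}"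
  then obtain i where i: "i \<le> k" "\<mu> = (\<sigma> i)\<^sup>2" by auto
  have "\<sigma> i \<le> \<sigma> k" using mono[of i k] i by (cases "i = k") auto
  then show "is_eigenvalue G L \<mu> \<and> \<mu> \<le> (\<sigma> k)\<^sup>2" using ev nonneg i by (simp add: power_mono)
qed auto

text \<open>
  The frequencies are \<open>0\<close> and one from each of the \<open>k\<close> disjoint windows
  \<open>(i \<pi> / L e, (i + 1) \<pi> / L e)\<close> with \<open>i < k\<close>.
\<close>

lemma eigenval_less_of_two_arcs:
  assumes tree: "undirected_tree G" and e: "e \<in> arcs G" and more: "arcs G \<noteq> {e}" and k: "1 \<le> k"
  shows "eigenval G L (k + 1) < (real k * pi / L e)\<^sup>2"
proof -
  have l: "0 < L e" using length_pos[OF e] .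
  have "\<exists>s. real i * pi / L e < s \<and> s < real (Suc i) * pi / L e \<and> is_eigenvalue G L (s\<^sup>2)" for i
    using frequency_in_window[OF tree e more, of "real i * pi / L e"] l
    by (simp add: add_divide_distrib algebra_simps)
  then obtain \<rho> where \<rho>: "\<And>i. real i * pi / L e < \<rho> i" "\<And>i. \<rho> i < real (Suc i) * pi / L e"
    "\<And>i. is_eigenvalue G L ((\<rho> i)\<^sup>2)" by metis
  define \<sigma> where "\<sigma> i = (case i of 0 \<Rightarrow> 0 | Suc j \<Rightarrow> \<rho> j)" for i
  have upper: "\<sigma> i \<le> real i * pi / L e" for i
    using \<rho>(2) by (auto simp: \<sigma>_def less_imp_le split: nat.split)
  have lower: "real i * pi / L e < \<sigma> (Suc i)" for i using \<rho>(1) by (simp add: \<sigma>_def)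
  have "eigenval G L (k + 1) \<le> (\<sigma> k)\<^sup>2"
  proof (rule eigenval_le_frequency)
    show "is_eigenvalue G L ((\<sigma> i)\<^sup>2)" for i
      using \<rho>(3) eigenvalue_0 by (cases i) (simp_all add: \<sigma>_def)
    show mono: "\<sigma> i < \<sigma> j" if ij: "i < j" for i j
    proof -
      obtain m where m: "j = Suc m" using ij by (cases j) auto
      then have im: "i \<le> m" using ij by simp
      have "\<sigma> i \<le> real i * pi / L e" by (rule upper)
      also have "\<dots> \<le> real m * pi / L e" using im l by (intro divide_right_mono mult_right_mono) auto
      also have "\<dots> < \<sigma> j" unfolding m by (rule lower)
      finally show ?thesis .
    qed
    show "0 \<le> \<sigma> i" for i using mono[of 0 i] by (cases i) (auto simp: \<sigma>_def)
  qed
  also have "(\<sigma> k)\<^sup>2 < (real k * pi / L e)\<^sup>2"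
  proof (rule power_strict_mono)
    obtain m where m: "k = Suc m" using k by (cases k) auto
    show "\<sigma> k < real k * pi / L e" using \<rho>(2)[of m] by (simp add: m \<sigma>_def)
    have "0 \<le> real m * pi / L e" using l by simp
    then show "0 \<le> \<sigma> k" using lower[of m] m by simp
  qed simp
  finally show ?thesis .
qed

lemma eigenval_le_of_arc:
  assumes tree: "undirected_tree G" and e: "e \<in> arcs G" and k: "1 \<le> k"
  shows "eigenval G L (k + 1) \<le> (real k * pi / L e)\<^sup>2"
proof (cases "arcs G = {e}")
  case True
  have l: "0 < L e" using length_pos[OF e] .
  show ?thesis
    by (rule eigenval_le_frequency[where \<sigma> = "\<lambda>i. real i * pi / L e"])
      (use single_edge_frequencies[OF tree True] l in \<open>auto simp: divide_strict_right_mono\<close>)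
next
  case False
  then show ?thesis using eigenval_less_of_two_arcs[OF tree e False k] by simp
qed

end


section \<open>The eigenvalue estimate\<close>

theorem corollary4p2:
  fixes G :: "('v, 'e) pre_digraph" and L :: "'e \<Rightarrow> real"
  assumes "metric_graph G L" and "undirected_tree G"
  shows "(\<forall>k::nat. 1 \<le> k \<longrightarrow>
            eigenval G L (k + 1) \<le> (real k)\<^sup>2 * pi\<^sup>2 / (max_length G L)\<^sup>2) \<and>
         ((\<exists>e \<in> arcs G. \<exists>e' \<in> arcs G. L e / L e' \<notin> \<rat>) \<longrightarrow>
            (\<forall>k::nat. 1 \<le> k \<longrightarrow>
               eigenval G L (k + 1) < (real k)\<^sup>2 * pi\<^sup>2 / (max_length G L)\<^sup>2))"
proof -
  interpret metric_graph G L by fact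
  have "max_length G L \<in> L ` arcs G"
    unfolding max_length_def using arcs_nonempty by (intro Max_in) auto
  then obtain m where m: "m \<in> arcs G" "max_length G L = L m" by blast
  have sq: "(real k)\<^sup>2 * pi\<^sup>2 / (max_length G L)\<^sup>2 = (real k * pi / L m)\<^sup>2" for k
    by (simp add: m(2) power_mult_distrib power_divide)
  have "arcs G \<noteq> {m}" if "e \<in> arcs G" "e' \<in> arcs G" "L e / L e' \<notin> \<rat>" for e e'
  proof
    assume "arcs G = {m}"
    then have "e = e'" using that by auto
    then show False using that length_pos[of e] by simp
  qed
  then show ?thesis
    unfolding sq using eigenval_le_of_arc[OF assms(2) m(1)] eigenval_less_of_two_arcs[OF assms(2) m(1)]
    by blast
qed

end
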